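(* Let $G$ be a finite abelian group of exponent $e$, and let $q$ be a prime power coprime to $|G|$. Then each irreducible representation of $G$ over the field $\mathbb{F}_q$ with $q$ elements has degree $\mathrm{ord}(q \bmod d)$ for some divisor $d$ of $e$. Moreover, for every positive integer $n$, the number of irreducible representations of $G$ of degree $n$ over $\mathbb{F}_q$, up to equivalence, is $$\frac{1}{n} \sum_{d \in D_n} |\mathrm{I}_d(G)|,$$ where $D_n$ is the set of positive divisors $d$ of $e$ such that $\mathrm{ord}(q \bmod d) = n$ and such that $d$ is even if $e$ is even.
   Context: For integers $q$ and $d \geq 1$ that are coprime, $\mathrm{ord}(q \bmod d)$ denotes the smallest positive integer $n$ such that $d$ divides $q^n - 1$; in particular $\mathrm{ord}(q \bmod 1) = 1$. For a finite abelian group $G$, $\mathrm{Irr}(G)$ denotes the set of irreducible complex characters of $G$ (all of degree $1$). For $\chi \in \mathrm{Irr}(G)$, the character field is $\mathbb{Q}(\chi) = \mathbb{Q}(\{\chi(g) : g \in G\})$. For a positive integer $d$, $\zeta_d$ denotes a primitive complex $d$-th root of unity, and $\mathrm{I}_d(G) = \{\chi \in \mathrm{Irr}(G) : \mathbb{Q}(\chi) = \mathbb{Q}(\zeta_d)\}$. (Thus $\mathrm{I}_d(G) = \mathrm{I}_{2d}(G)$ for odd $d$.) The degree of a representation over $\mathbb{F}_q$ is its dimension as an $\mathbb{F}_q$-vector space; irreducible means irreducible over $\mathbb{F}_q$. *)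

theory Defs
  imports
    "HOL-Algebra.Generated_Fields"
    "HOL-Number_Theory.Number_Theory"
    "Jordan_Normal_Form.VS_Connect"
    Complex_Main
begin

definition group_exponent :: "('g, 'b) monoid_scheme \<Rightarrow> nat" where
  "group_exponent G = (LEAST n::nat. n > 0 \<and> (\<forall>x\<in>carrier G. x [^]\<^bsub>G\<^esub> n = \<one>\<^bsub>G\<^esub>))"

text \<open>
  A representation of degree \<open>n\<close> over the field \<open>'k\<close> acts on the column space \<open>'k\<^sup>n\<close>, so it is a
  homomorphism from \<open>G\<close> to the group of invertible \<open>n \<times> n\<close> matrices.  The values outside
  \<open>carrier G\<close> are unconstrained and play no role below.
\<close>

definition GL :: "'k :: field itself \<Rightarrow> nat \<Rightarrow> 'k mat monoid" where
  "GL K n = units_of (ring_mat K n ())"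

definition representation ::
  "('g, 'b) monoid_scheme \<Rightarrow> nat \<Rightarrow> ('g \<Rightarrow> 'k :: field mat) \<Rightarrow> bool" where
  "representation G n \<rho> \<longleftrightarrow> \<rho> \<in> hom G (GL TYPE('k) n)"

definition invariant_subspace ::
  "('g, 'b) monoid_scheme \<Rightarrow> nat \<Rightarrow> ('g \<Rightarrow> 'k :: field mat) \<Rightarrow> 'k vec set \<Rightarrow> bool" where
  "invariant_subspace G n \<rho> W \<longleftrightarrow>
     subspace class_ring W (module_vec TYPE('k) n) \<and> (\<forall>g\<in>carrier G. \<forall>w\<in>W. \<rho> g *\<^sub>v w \<in> W)"

definition irreducible_rep ::
  "('g, 'b) monoid_scheme \<Rightarrow> nat \<Rightarrow> ('g \<Rightarrow> 'k :: field mat) \<Rightarrow> bool" where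
  "irreducible_rep G n \<rho> \<longleftrightarrow>
     representation G n \<rho> \<and> n > 0 \<and>
     (\<forall>W. invariant_subspace G n \<rho> W \<longrightarrow> W = {0\<^sub>v n} \<or> W = carrier_vec n)"

definition equivalent_reps ::
  "('g, 'b) monoid_scheme \<Rightarrow> nat \<Rightarrow> ('g \<Rightarrow> 'k :: field mat) \<Rightarrow> ('g \<Rightarrow> 'k mat) \<Rightarrow> bool" where
  "equivalent_reps G n \<rho> \<sigma> \<longleftrightarrow>
     (\<exists>P\<in>carrier (GL TYPE('k) n). \<forall>g\<in>carrier G. P * \<rho> g = \<sigma> g * P)"

definition irrep_classes ::
  "'k :: field itself \<Rightarrow> ('g, 'b) monoid_scheme \<Rightarrow> nat \<Rightarrow> ('g \<Rightarrow> 'k mat) set set" where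
  "irrep_classes K G n =
     {\<rho> :: 'g \<Rightarrow> 'k mat. irreducible_rep G n \<rho>} //
     {(\<rho>, \<sigma>). irreducible_rep G n \<rho> \<and> irreducible_rep G n \<sigma> \<and> equivalent_reps G n \<rho> \<sigma>}"

definition mat_trace :: "'k :: comm_monoid_add mat \<Rightarrow> 'k" where
  "mat_trace A = (\<Sum>i<dim_row A. A $$ (i, i))"

text \<open>
  Characters are restricted to \<open>carrier G\<close>, so that they are determined by their values there and
  cardinalities of sets of characters are the intended ones.
\<close>

definition Irr :: "('g, 'b) monoid_scheme \<Rightarrow> ('g \<Rightarrow> complex) set" where
  "Irr G = {restrict (\<lambda>g. mat_trace (\<rho> g)) (carrier G) | n \<rho>. irreducible_rep G n \<rho>}"

text \<open>
  Every subfield of the complex numbers contains \<open>\<rat>\<close>, so \<open>\<rat>(S)\<close> is the subfield generated by \<open>S\<close>.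
\<close>

definition rat_adjoin :: "complex set \<Rightarrow> complex set" where
  "rat_adjoin S = generate_field class_ring S"

definition character_field :: "('g, 'b) monoid_scheme \<Rightarrow> ('g \<Rightarrow> complex) \<Rightarrow> complex set" where
  "character_field G \<chi> = rat_adjoin (\<chi> ` carrier G)"

definition I_chars :: "nat \<Rightarrow> ('g, 'b) monoid_scheme \<Rightarrow> ('g \<Rightarrow> complex) set" where
  "I_chars d G = {\<chi> \<in> Irr G. character_field G \<chi> = rat_adjoin {cis (2 * pi / real d)}}"

end

theory Submission
  imports Defs "HOL-Algebra.Algebraic_Closure_Type" "Jordan_Normal_Form.Char_Poly"
begin

text \<open>
  Let \<open>F\<close> be the field with \<open>q\<close> elements and \<open>K\<close> an algebraic closure of it.  Among the
  \<open>F\<close>-linear maps from the space \<open>V\<close> of an irreducible representation \<open>\<rho>\<close> to \<open>K\<close> there is a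
  nonzero \<open>\<Lambda>\<close> on which \<open>G\<close> acts through a character: \<open>\<Lambda> (\<rho> g u) = \<chi> g * \<Lambda> u\<close> with
  \<open>\<chi> : G \<rightarrow> K\<^sup>*\<close> (\<open>occurs_exists\<close>).  The kernel of \<open>\<Lambda>\<close> is an invariant subspace, so \<open>\<Lambda>\<close> is
  injective, and its image is a line over the field \<open>L\<close> spanned over \<open>F\<close> by the values of \<open>\<chi>\<close>
  (\<open>eigenfunctional_image\<close>).  Hence \<open>\<rho>\<close> is equivalent to the action of \<open>G\<close> on \<open>L\<close> by
  multiplication with the values of \<open>\<chi>\<close>.  So \<open>\<chi>\<close> determines \<open>\<rho>\<close> up to equivalence
  (\<open>occurs_imp_equivalent\<close>), every character arises (\<open>char_occurs_in_irreducible\<close>), and the degree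
  is \<open>n = [L : F]\<close>, the least \<open>n > 0\<close> with \<open>\<chi>\<^sup>q\<^sup>^\<^sup>n = \<chi>\<close>, which is \<open>ord(q mod m)\<close> for the
  order \<open>m\<close> of \<open>\<chi>\<close> (\<open>degree_eq_ord\<close>); this gives the first claim, because \<open>m\<close> divides \<open>e\<close>.  The
  characters that occur in \<open>\<rho>\<close> form one Frobenius orbit and number exactly \<open>n\<close>
  (\<open>occurring_chars\<close>).  Therefore \<open>n\<close> times the number of classes is the number of characters
  \<open>G \<rightarrow> K\<^sup>*\<close> whose order \<open>m\<close> satisfies \<open>ord(q mod m) = n\<close> (\<open>irrep_classes_count\<close>).

  Since \<open>q\<close> is coprime to \<open>|G|\<close>, the fields \<open>K\<close> and \<open>\<complex>\<close> both contain a primitive \<open>e\<close>-th root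
  of unity, and so \<open>G\<close> has equally many characters of each order over the two fields
  (\<open>card_chars_eq\<close>).  Over \<open>\<complex>\<close> the same functional \<open>\<Lambda>\<close> embeds \<open>V\<close> in \<open>\<complex>\<close>, so irreducible
  representations have degree 1 and \<open>Irr G\<close> consists of the characters \<open>G \<rightarrow> \<complex>\<^sup>*\<close>
  (\<open>Irr_eq_chars\<close>).  A character of order \<open>m\<close> takes all \<open>m\<close>-th roots of unity as values, so
  its field is \<open>\<rat>(\<zeta>\<^sub>m)\<close>.  It equals \<open>\<rat>(\<zeta>\<^sub>d)\<close> just if \<open>m = d\<close>, or one of \<open>m\<close>, \<open>d\<close> is odd and the
  other its double (\<open>rat_adjoin_zeta_eq_iff\<close>).  The parity condition on \<open>D\<^sub>n\<close> selects one of the two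
  names of each field, and doubling an odd \<open>m\<close> does not change \<open>ord(q mod m)\<close> for odd \<open>q\<close>; hence the
  sum over \<open>D\<^sub>n\<close> counts each complex character with \<open>ord(q mod m) = n\<close> once (\<open>sum_I_chars\<close>).

  What makes distinct cyclotomic fields distinct is the Galois action on roots of unity: an integer
  polynomial that vanishes at an \<open>n\<close>-th root of unity \<open>z\<close> also vanishes at \<open>z\<^sup>a\<close> for all \<open>a\<close> coprime
  to \<open>n\<close> (\<open>power_coprime_root\<close>).  It follows from an argument of Landau, reduction modulo large
  primes.
\<close>

section \<open>Cyclotomic integers\<close>

text \<open>Elements of \<open>\<int>[z]\<close> are handled through integer polynomials that represent them.\<close>
abbreviation zval :: "int poly \<Rightarrow> complex \<Rightarrow> complex" where
  "zval h z \<equiv> poly (map_poly of_int h) z"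

lemma zval_simps:
  "zval 0 z = 0" "zval 1 z = 1" "zval (pCons a h) z = of_int a + z * zval h z"
  "zval (f + h) z = zval f z + zval h z" "zval (- h) z = - zval h z"
  "zval (f - h) z = zval f z - zval h z"
  "zval (f * h) z = zval f z * zval h z" "zval (h ^ k) z = zval h z ^ k"
  "zval (Polynomial.smult a h) z = of_int a * zval h z"
  "zval (Polynomial.monom a k) z = of_int a * z ^ k"
  "zval (pcompose f h) z = zval f (zval h z)"
  by (simp_all add: hom_distribs of_int_hom.map_poly_pcompose poly_pcompose poly_monom)

lemma power_mod_eq:
  fixes z :: "'a :: monoid_mult"
  assumes "z ^ n = 1"
  shows "z ^ (m mod n) = z ^ m"
proof -
  have "z ^ m = z ^ (n * (m div n) + m mod n)" by simp
  also have "\<dots> = z ^ (m mod n)" by (simp only: power_add power_mult assms) simp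
  finally show ?thesis by simp
qed

text \<open>Multiplication by an element of \<open>\<int>[z]\<close> sends the generators
  \<open>1, z, \<dots>, z\<^sup>n\<^sup>-\<^sup>1\<close> to integer combinations of them.  The element is therefore an eigenvalue of an integer
  (circulant) matrix and a root of its characteristic polynomial.\<close>
lemma cyclotomic_integer_monic_root:
  assumes z: "z ^ n = 1" and n: "n > 0"
  shows "\<exists>f. Polynomial.lead_coeff f = 1 \<and> zval f (zval h z) = 0"
proof -
  define y where "y = zval h z"
  define A where "A = mat n n (\<lambda>(i,j). \<Sum>k\<le>Polynomial.degree h. if (k + i) mod n = j then poly.coeff h k else 0)"
  define v where "v = vec n (\<lambda>i. z ^ i)"
  let ?A = "map_mat of_int A :: complex mat"
  have A: "A \<in> carrier_mat n n" by (simp add: A_def)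
  note zmod = power_mod_eq[OF z]
  have y: "y = (\<Sum>k\<le>Polynomial.degree h. of_int (poly.coeff h k) * z ^ k)"
    by (simp add: y_def poly_altdef)
  have "?A *\<^sub>v v = y \<cdot>\<^sub>v v"
  proof (rule eq_vecI)
    fix i assume "i < dim_vec (y \<cdot>\<^sub>v v)"
    hence i: "i < n" by (simp add: v_def)
    have "(?A *\<^sub>v v) $ i = (\<Sum>j<n. (\<Sum>k\<le>Polynomial.degree h. if (k + i) mod n = j then of_int (poly.coeff h k) else 0) * z ^ j)"
      using i by (simp add: A_def v_def scalar_prod_def lessThan_atLeast0 if_distrib[of of_int] cong: if_cong)
    also have "\<dots> = (\<Sum>k\<le>Polynomial.degree h. \<Sum>j<n. if (k + i) mod n = j then of_int (poly.coeff h k) * z ^ j else 0)"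
      unfolding sum_distrib_right by (subst sum.swap) (auto intro!: sum.cong)
    also have "\<dots> = (\<Sum>k\<le>Polynomial.degree h. of_int (poly.coeff h k) * z ^ ((k + i) mod n))"
      using n by (intro sum.cong refl) simp
    also have "\<dots> = y * z ^ i"
      by (simp add: zmod y sum_distrib_right power_add mult.assoc)
    finally show "(?A *\<^sub>v v) $ i = (y \<cdot>\<^sub>v v) $ i" using i by (simp add: v_def)
  qed (simp add: A_def v_def)
  moreover have "v \<noteq> 0\<^sub>v n"
  proof
    assume "v = 0\<^sub>v n"
    hence "v $ 0 = 0\<^sub>v n $ 0" by simp
    thus False using n by (simp add: v_def)
  qed
  ultimately have "eigenvalue ?A y"
    unfolding eigenvalue_def eigenvector_def using A by (intro exI[of _ v]) (simp add: v_def)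
  hence "poly (char_poly ?A) y = 0"
    using eigenvalue_root_char_poly[of ?A n y] A by simp
  hence "zval (char_poly A) y = 0" unfolding of_int_hom.char_poly_hom[OF A] .
  moreover have "Polynomial.lead_coeff (char_poly A) = 1" using degree_monic_char_poly[OF A] by simp
  ultimately show ?thesis unfolding y_def by blast
qed

text \<open>The constant term of an integer polynomial of least degree with root \<open>y \<noteq> 0\<close> is nonzero and a
  multiple of \<open>y\<close>.  It serves as a substitute for the norm of \<open>y\<close>.\<close>
lemma cyclotomic_integer_divides_integer:
  assumes z: "z ^ n = 1" and n: "n > 0" and nz: "zval h z \<noteq> 0"
  shows "\<exists>k c. c \<noteq> 0 \<and> zval k z * zval h z = of_int c"
proof -
  define y where "y = zval h z"
  define P where "P f \<longleftrightarrow> f \<noteq> 0 \<and> zval f y = 0" for f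
  obtain f0 where f0: "Polynomial.lead_coeff f0 = 1" "zval f0 y = 0"
    using cyclotomic_integer_monic_root[OF z n, of h] unfolding y_def by blast
  hence "P f0" by (auto simp: P_def)
  then obtain f where f: "P f" and min: "\<And>g. P g \<Longrightarrow> Polynomial.degree f \<le> Polynomial.degree g"
    using ex_has_least_nat[of P f0 Polynomial.degree] by blast
  obtain a r where fr: "f = pCons a r" by (cases f) auto
  have "a \<noteq> 0"
  proof
    assume "a = 0"
    hence "P r" "r \<noteq> 0" using f nz unfolding P_def fr y_def by (auto simp: zval_simps)
    thus False using min[of r] fr by simp
  qed
  moreover have "zval (- pcompose r h) z * zval h z = of_int a"
    using f unfolding P_def fr y_def by (simp add: zval_simps neg_eq_iff_add_eq_0 mult.commute add.commute)
  ultimately show ?thesis by (intro exI[of _ "- pcompose r h"] exI[of _ a]) simp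
qed

text \<open>The value \<open>y\<close> divides some nonzero integer \<open>c\<close>.  A prime that divides \<open>y\<close> in \<open>\<int>[z]\<close> divides \<open>c\<close>
  there, and hence in \<open>\<int>\<close>, as a rational algebraic integer is an integer; so it is at most \<open>|c|\<close>.\<close>
lemma cyclotomic_integer_bounded_primes:
  assumes z: "z ^ n = 1" and n: "n > 0" and nz: "zval h z \<noteq> 0"
  shows "\<exists>A::nat. \<forall>p g. Factorial_Ring.prime p \<longrightarrow> A < p \<longrightarrow> zval h z \<noteq> of_nat p * zval g z"
proof -
  obtain k c where c: "c \<noteq> 0" "zval k z * zval h z = of_int c"
    using cyclotomic_integer_divides_integer[OF assms] by blast
  have "False" if p: "Factorial_Ring.prime p" "nat \<bar>c\<bar> < p" and g: "zval h z = of_nat p * zval g z" for p g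
  proof -
    define w where "w = zval (k * g) z"
    have pw: "of_nat p * w = of_int c" using c(2) g by (simp add: w_def zval_simps mult_ac)
    have p0: "p > 0" using p prime_gt_0_nat by simp
    have "algebraic_int w"
      using cyclotomic_integer_monic_root[OF z n, of "k * g"] unfolding w_def algebraic_int_altdef_ipoly by blast
    moreover have "w = of_int c / of_nat p" using pw p0 by (simp add: field_simps)
    hence "w \<in> \<rat>" by simp
    ultimately have "w \<in> \<int>" by (rule rational_algebraic_int_is_int)
    then obtain i where "w = of_int i" by (auto elim: Ints_cases)
    hence "of_int (int p * i) = (of_int c :: complex)" using pw by simp
    hence "int p * i = c" by (simp only: of_int_eq_iff)
    hence "int p dvd c" by auto
    hence "int p \<le> \<bar>c\<bar>" using dvd_imp_le_int[OF c(1)] by fastforce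
    thus False using p(2) by linarith
  qed
  thus ?thesis by blast
qed

lemma prime_power_add_mod:
  fixes x y :: "'a :: comm_ring_1"
  assumes p: "Factorial_Ring.prime (p::nat)"
  shows "\<exists>r. (x + y) ^ p = x ^ p + y ^ p + of_nat p * r"
proof -
  have p0: "p > 0" using p prime_gt_0_nat by simp
  have dvd: "\<exists>r. of_nat (p choose k) * x ^ k * y ^ (p - k) = of_nat p * r" if "k \<in> {0<..<p}" for k
  proof -
    have "p dvd (p choose k)" using that p by (intro dvd_choose_prime) auto
    then obtain c where "p choose k = p * c" by blast
    thus ?thesis by (intro exI[of _ "of_nat c * x ^ k * y ^ (p - k)"]) (simp add: mult.assoc)
  qed
  then obtain r where r: "\<And>k. k \<in> {0<..<p} \<Longrightarrow> of_nat (p choose k) * x ^ k * y ^ (p - k) = of_nat p * r k"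
    by metis
  have "{..p} = insert 0 (insert p {0<..<p})" using p0 by auto
  hence "(x + y) ^ p = x ^ p + y ^ p + (\<Sum>k\<in>{0<..<p}. of_nat (p choose k) * x ^ k * y ^ (p - k))"
    unfolding binomial_ring using p0 by (simp add: add_ac)
  also have "\<dots> = x ^ p + y ^ p + of_nat p * (\<Sum>k\<in>{0<..<p}. r k)"
    using r by (simp add: sum_distrib_left)
  finally show ?thesis by blast
qed

text \<open>Fermat's little theorem for all integers, in the form in which it lifts to polynomials.\<close>
lemma int_power_prime_cong:
  assumes "Factorial_Ring.prime (p::nat)"
  shows "\<exists>s. a ^ p = a + int p * s"
proof -
  have nn: "\<exists>s. int m ^ p = int m + int p * s" for m
  proof (induction m)
    case 0 show ?case using assms prime_gt_0_nat by (intro exI[of _ 0]) simp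
  next
    case (Suc m)
    then obtain s where s: "int m ^ p = int m + int p * s" by blast
    obtain r where "(int m + 1) ^ p = int m ^ p + 1 ^ p + of_nat p * r"
      using prime_power_add_mod[OF assms] by blast
    thus ?case using s by (intro exI[of _ "s + r"]) (simp add: algebra_simps)
  qed
  define b where "b = nat (a mod int p)"
  have p0: "p > 0" using assms prime_gt_0_nat by simp
  have "[a = int b] (mod int p)" using p0 by (simp add: b_def cong_def)
  hence "[a ^ p = int b ^ p] (mod int p)" by (rule cong_pow)
  also have "[int b ^ p = int b] (mod int p)" using nn[of b] by (metis cong_iff_lin cong_sym)
  also have "[int b = a] (mod int p)" using p0 by (simp add: b_def cong_def)
  finally show ?thesis by (metis cong_iff_lin cong_sym)
qed

text \<open>The Frobenius congruence \<open>F(X)\<^sup>p \<equiv> F(X\<^sup>p)\<close> modulo \<open>p\<close>.\<close>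
lemma poly_power_prime_cong:
  fixes F :: "int poly"
  assumes p: "Factorial_Ring.prime (p::nat)"
  shows "\<exists>g. F ^ p = pcompose F (Polynomial.monom 1 p) + Polynomial.smult (int p) g"
proof (induction F)
  case 0 show ?case using p prime_gt_0_nat by (intro exI[of _ 0]) simp
next
  case (pCons a F)
  then obtain g where g: "F ^ p = pcompose F (Polynomial.monom 1 p) + Polynomial.smult (int p) g" by blast
  obtain s where s: "a ^ p = a + int p * s" using int_power_prime_cong[OF p] by blast
  obtain r where r: "([:a:] + [:0,1:] * F) ^ p = [:a:] ^ p + ([:0,1:] * F) ^ p + of_nat p * r"
    using prime_power_add_mod[OF p] by blast
  have 1: "pCons a F = [:a:] + [:0,1:] * F" by simp
  have 2: "[:a:] ^ p = [:a:] + Polynomial.smult (int p) [:s:]" using s by (simp add: poly_const_pow)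
  have 3: "[:0,1:] ^ p = (Polynomial.monom 1 p :: int poly)" by (simp add: monom_altdef)
  have 4: "of_nat p * r = Polynomial.smult (int p) r" by (simp add: of_nat_poly)
  have "(pCons a F) ^ p = [:a:] + Polynomial.smult (int p) [:s:] + Polynomial.monom 1 p * (pcompose F (Polynomial.monom 1 p) + Polynomial.smult (int p) g) + Polynomial.smult (int p) r"
    unfolding 1 r 2 4 power_mult_distrib 3 g by (simp add: mult_ac)
  also have "\<dots> = pcompose (pCons a F) (Polynomial.monom 1 p) + Polynomial.smult (int p) ([:s:] + Polynomial.monom 1 p * g + r)"
    by (simp add: pcompose_pCons algebra_simps smult_add_right)
  finally show ?case by blast
qed

text \<open>By the Frobenius congruence \<open>F(z\<^sup>j) = 0\<close> makes \<open>F(z\<^sup>j\<^sup>p)\<close> a multiple of \<open>p\<close> in \<open>\<int>[z]\<close>.  Only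
  finitely many values \<open>F(z\<^sup>j)\<close> exist, so one bound \<open>B\<close> works for all of them: for \<open>p > B\<close> such a
  value must vanish.  Finally \<open>a\<close> may be replaced by a number \<open>a'\<close> in its class modulo \<open>n\<close> all of
  whose prime factors exceed \<open>B\<close>, and \<open>z\<^sup>a\<^sup>'\<close> is reached one prime at a time.\<close>
lemma power_coprime_root:
  assumes z: "z ^ n = 1" and n: "n > 0" and F: "zval F z = 0" and a: "coprime a n"
  shows "zval F (z ^ a) = 0"
proof -
  note zmod = power_mod_eq[OF z]
  have conj: "zval (pcompose f (Polynomial.monom 1 j)) z = zval f (z ^ j)" for f j
    by (simp add: zval_simps poly_monom)
  have "\<exists>A. \<forall>p g. zval F (z ^ j) \<noteq> 0 \<longrightarrow> Factorial_Ring.prime p \<longrightarrow> A < p \<longrightarrow> zval F (z ^ j) \<noteq> of_nat p * zval g z" for j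
    using cyclotomic_integer_bounded_primes[OF z n, of "pcompose F (Polynomial.monom 1 j)"] unfolding conj
    by (cases "zval F (z ^ j) = 0") auto
  then obtain A where A: "\<And>j p g. zval F (z ^ j) \<noteq> 0 \<Longrightarrow> Factorial_Ring.prime p \<Longrightarrow> A j < p \<Longrightarrow> zval F (z ^ j) \<noteq> of_nat p * zval g z"
    by metis
  define B where "B = Max (A ` {..<n})"
  have AB: "A (j mod n) \<le> B" for j unfolding B_def using n by (intro Max_ge) auto
  have step: "zval F (z ^ (j * p)) = 0" if p: "Factorial_Ring.prime p" "B < p" and j: "zval F (z ^ j) = 0" for p j
  proof (rule ccontr)
    assume nz: "zval F (z ^ (j * p)) \<noteq> 0"
    obtain g where g: "F ^ p = pcompose F (Polynomial.monom 1 p) + Polynomial.smult (int p) g"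
      using poly_power_prime_cong[OF p(1)] by blast
    have p0: "p > 0" using p prime_gt_0_nat by simp
    have "zval (F ^ p) (z ^ j) = zval F (z ^ (j * p)) + of_nat p * zval g (z ^ j)"
      unfolding g by (simp add: zval_simps poly_monom power_mult)
    moreover have "zval (F ^ p) (z ^ j) = 0" using j p0 by (simp add: zval_simps)
    ultimately have "zval F (z ^ (j * p)) = of_nat p * zval (pcompose (- g) (Polynomial.monom 1 j)) z"
      unfolding conj by (simp add: zval_simps eq_neg_iff_add_eq_0)
    moreover have "A (j * p mod n) < p" using AB[of "j * p"] p(2) by simp
    ultimately show False using A[of "j * p mod n" p] nz p(1) unfolding zmod by blast
  qed
  \<comment> \<open>A prime \<open>p \<le> B\<close> divides exactly one of the two summands: if \<open>p\<close> divides \<open>a\<close>, it divides neither \<open>n\<close> nor the product.\<close>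
  define a' where "a' = a + n * \<Prod>{p. Factorial_Ring.prime p \<and> p \<le> B \<and> \<not> p dvd a}"
  let ?S = "{p. Factorial_Ring.prime p \<and> p \<le> B \<and> \<not> p dvd a}"
  have finS: "finite ?S" by (rule finite_subset[of _ "{..B}"]) auto
  have big: "B < p" if p: "Factorial_Ring.prime p" "p dvd a'" for p
  proof (rule ccontr)
    assume "\<not> B < p"
    show False
    proof (cases "p dvd a")
      case True
      hence "p dvd n * \<Prod>?S" using p(2) unfolding a'_def by (simp add: dvd_add_right_iff)
      hence "p dvd n \<or> p dvd \<Prod>?S" using p(1) by (simp add: prime_dvd_mult_iff)
      moreover have "\<not> p dvd n" using True a p(1) coprime_common_divisor[of a n p] by (auto simp: not_prime_1)
      moreover have "\<not> p dvd \<Prod>?S"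
      proof
        assume "p dvd \<Prod>?S"
        hence "\<exists>r\<in>?S. p dvd r"
          using prime_dvd_prod_iff[OF finS p(1), of "\<lambda>x. x"] by (simp only:)
        then obtain r where r: "Factorial_Ring.prime r" "\<not> r dvd a" "p dvd r" by blast
        have "p = r" by (rule primes_dvd_imp_eq[OF p(1) r(1,3)])
        thus False using True r by simp
      qed
      ultimately show False by blast
    next
      case False
      hence "p \<in> ?S" using p \<open>\<not> B < p\<close> by simp
      hence "p dvd \<Prod>?S" using dvd_prodI[OF finS, of p "\<lambda>x. x"] by simp
    hence "p dvd n * \<Prod>?S" by (rule dvd_mult)
      thus False using False p(2) unfolding a'_def by (simp add: dvd_add_left_iff)
    qed
  qed
  have "a' > 0"
  proof -
    have "\<Prod>?S > 0" using finS prime_gt_0_nat by (intro prod_pos) auto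
    thus ?thesis using n by (simp add: a'_def)
  qed
  moreover have "zval F (z ^ m) = 0" if "m > 0" "\<And>p. Factorial_Ring.prime p \<Longrightarrow> p dvd m \<Longrightarrow> B < p" for m
    using that
  proof (induction m rule: prime_divisors_induct)
    case zero thus ?case by simp
  next
    case (unit m) thus ?case using F by simp
  next
    case (factor p m)
    have "zval F (z ^ m) = 0" using factor by (intro factor.IH) (auto intro: Nat.gr0I)
    thus ?case using step[of p m] factor by (simp add: mult.commute)
  qed
  ultimately have "zval F (z ^ a') = 0" using big by blast
  moreover have "z ^ a' = z ^ a" by (simp add: a'_def power_add power_mult z)
  ultimately show ?thesis by simp
qed

section \<open>Cyclotomic fields\<close>

lemma class_ring_inv:
  fixes x :: "'a :: field"
  assumes "x \<noteq> 0"
  shows "inv\<^bsub>class_ring\<^esub> x = inverse x"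
  using assms comm_monoid.comm_inv_char[OF class_cring.comm_monoid_axioms, of x "inverse x"]
  by (simp add: matrix_vs_simps)

lemma rat_adjoin_closed:
  shows "1 \<in> rat_adjoin S"
    and "x \<in> S \<Longrightarrow> x \<in> rat_adjoin S"
    and "x \<in> rat_adjoin S \<Longrightarrow> - x \<in> rat_adjoin S"
    and "x \<in> rat_adjoin S \<Longrightarrow> x \<noteq> 0 \<Longrightarrow> inverse x \<in> rat_adjoin S"
    and "x \<in> rat_adjoin S \<Longrightarrow> y \<in> rat_adjoin S \<Longrightarrow> x + y \<in> rat_adjoin S"
    and "x \<in> rat_adjoin S \<Longrightarrow> y \<in> rat_adjoin S \<Longrightarrow> x * y \<in> rat_adjoin S"
  using generate_field.intros[where R = "class_ring :: complex ring" and H = S]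
  unfolding rat_adjoin_def by (simp_all add: matrix_vs_simps class_ring_inv)

lemma rat_adjoin_power: "x \<in> rat_adjoin S \<Longrightarrow> x ^ k \<in> rat_adjoin S"
  by (induction k) (auto intro: rat_adjoin_closed)

lemma rat_adjoin_power_int: "x \<in> rat_adjoin S \<Longrightarrow> x \<noteq> 0 \<Longrightarrow> x powi k \<in> rat_adjoin S"
  by (auto simp: power_int_def intro!: rat_adjoin_power rat_adjoin_closed(4))

lemma rat_adjoin_subset:
  assumes "S \<subseteq> rat_adjoin T"
  shows "rat_adjoin S \<subseteq> rat_adjoin T"
proof
  fix x assume "x \<in> rat_adjoin S"
  hence "x \<in> generate_field class_ring S" by (simp only: rat_adjoin_def)
  thus "x \<in> rat_adjoin T"
  proof induction
    case (m_inv h)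
    thus ?case by (simp add: matrix_vs_simps class_ring_inv rat_adjoin_closed)
  qed (use assms in \<open>auto simp: matrix_vs_simps intro: rat_adjoin_closed\<close>)
qed

definition zeta :: "nat \<Rightarrow> complex" where "zeta d = cis (2 * pi / real d)"

lemma zeta_power: "zeta d ^ k = cis (2 * pi * real k / real d)"
  by (simp add: zeta_def DeMoivre mult_ac)

lemma zeta_nonzero [simp]: "zeta d \<noteq> 0"
  by (simp add: zeta_def)

lemma zeta_power_self: "d > 0 \<Longrightarrow> zeta d ^ d = 1"
  by (simp add: zeta_power)

lemma zeta_mult_power: "k > 0 \<Longrightarrow> zeta (d * k) ^ k = zeta d"
  by (simp add: zeta_power) (simp add: zeta_def)

lemma zeta_power_eq_1_iff:
  assumes "d > 0"
  shows "zeta d ^ k = 1 \<longleftrightarrow> d dvd k"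
proof
  assume "d dvd k"
  thus "zeta d ^ k = 1" using zeta_power_self[OF assms] by (auto simp: power_mult)
next
  assume "zeta d ^ k = 1"
  hence "zeta d ^ (d * (k div d)) * zeta d ^ (k mod d) = 1" by (simp flip: power_add)
  hence "zeta d ^ (k mod d) = 1" by (simp add: power_mult zeta_power_self assms)
  hence eq: "cis (2 * pi * real (k mod d) / real d) = cis (2 * pi * real 0 / real d)"
    by (simp add: zeta_power)
  have "inj_on (\<lambda>k. cis (2 * pi * real k / real d)) {..<d}"
    using bij_betw_roots_unity[OF assms] by (simp add: bij_betw_def)
  from inj_onD[OF this eq] have "k mod d = 0" using assms by simp
  thus "d dvd k" by auto
qed

text \<open>Fractions with numerator in \<open>\<int>[\<zeta>\<^sub>d]\<close> and denominator in \<open>\<int>\<close> are closed under inversion, because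
  every nonzero element of \<open>\<int>[\<zeta>\<^sub>d]\<close> divides a nonzero integer.\<close>
lemma rat_adjoin_zeta_elem:
  assumes d: "d > 0" and x: "x \<in> rat_adjoin {zeta d}"
  shows "\<exists>N h. N \<noteq> 0 \<and> of_int N * x = zval h (zeta d)"
proof -
  from x have "x \<in> generate_field class_ring {zeta d}" by (simp only: rat_adjoin_def)
  thus ?thesis
  proof induction
    case one
    show ?case by (intro exI[of _ 1]) (simp add: zval_simps matrix_vs_simps exI[of _ 1])
  next
    case (incl h)
    thus ?case by (intro exI[of _ 1] exI[of _ "[:0, 1:]"]) (simp add: zval_simps)
  next
    case (a_inv x)
    then obtain N h where "N \<noteq> 0" "of_int N * x = zval h (zeta d)" by blast
    thus ?case by (intro exI[of _ N] exI[of _ "- h"]) (simp add: zval_simps matrix_vs_simps)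
  next
    case (m_inv x)
    then obtain N h where N: "N \<noteq> 0" "of_int N * x = zval h (zeta d)" by blast
    have x0: "x \<noteq> 0" using m_inv by (simp add: matrix_vs_simps)
    hence "zval h (zeta d) \<noteq> 0" using N by (metis mult_eq_0_iff of_int_eq_0_iff)
    then obtain k c where kc: "c \<noteq> 0" "zval k (zeta d) * zval h (zeta d) = of_int c"
      using cyclotomic_integer_divides_integer[OF zeta_power_self[OF d] d] by blast
    have "of_int c * inverse x = zval (Polynomial.smult N k) (zeta d)"
      using kc(2) x0 unfolding N(2)[symmetric] by (simp add: zval_simps field_simps)
    thus ?case using kc(1) x0 by (auto simp: class_ring_inv)
  next
    case (eng_add x y)
    then obtain N h M g where *: "N \<noteq> 0" "of_int N * x = zval h (zeta d)"
      "M \<noteq> 0" "of_int M * y = zval g (zeta d)" by blast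
    have "of_int (N * M) * (x + y) = of_int M * (of_int N * x) + of_int N * (of_int M * y)"
      by (simp add: algebra_simps)
    also have "\<dots> = zval (Polynomial.smult M h + Polynomial.smult N g) (zeta d)" by (simp add: * zval_simps)
    finally show ?case using * by (intro exI[of _ "N * M"]) (auto simp: matrix_vs_simps)
  next
    case (eng_mult x y)
    then obtain N h M g where *: "N \<noteq> 0" "of_int N * x = zval h (zeta d)"
      "M \<noteq> 0" "of_int M * y = zval g (zeta d)" by blast
    have "of_int (N * M) * (x * y) = (of_int N * x) * (of_int M * y)"
      by (simp add: algebra_simps)
    also have "\<dots> = zval (h * g) (zeta d)" by (simp add: * zval_simps)
    finally show ?case using * by (intro exI[of _ "N * M"]) (auto simp: matrix_vs_simps)
  qed
qed

text \<open>The automorphism \<open>\<zeta>\<^sub>m \<mapsto> \<zeta>\<^sub>m\<^sup>a\<close> fixes \<open>\<zeta>\<^sub>d\<close> when \<open>a \<equiv> 1\<close> modulo \<open>d\<close>.  If \<open>\<zeta>\<^sub>m\<close> is an expression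
  in \<open>\<zeta>\<^sub>d\<close>, it must be fixed as well.\<close>
lemma zeta_fixed_by_galois:
  assumes m: "m > 0" and dm: "d dvd m" and mem: "zeta m \<in> rat_adjoin {zeta d}"
    and a: "coprime a m" and ad: "[a = 1] (mod d)"
  shows "[a = 1] (mod m)"
proof -
  obtain k where k: "m = d * k" using dm by blast
  have d: "d > 0" "k > 0" using m k by auto
  let ?z = "zeta m"
  have zk: "?z ^ k = zeta d" using d k zeta_mult_power by simp
  obtain N h where N: "N \<noteq> 0" "of_int N * ?z = zval h (zeta d)"
    using rat_adjoin_zeta_elem[OF d(1) mem] by blast
  define F where "F = Polynomial.smult N [:0, 1:] - pcompose h (Polynomial.monom 1 k)"
  have F: "zval F w = of_int N * w - zval h (w ^ k)" for w
    unfolding F_def by (simp add: zval_simps poly_monom)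
  have "zval F ?z = 0" using N zk by (simp add: F)
  hence "zval F (?z ^ a) = 0"
    by (rule power_coprime_root[OF zeta_power_self[OF m] m _ a])
  moreover have "(?z ^ a) ^ k = zeta d"
  proof -
    have "(?z ^ a) ^ k = zeta d ^ a" unfolding zk[symmetric] by (simp add: power_mult[symmetric] mult.commute)
    also have "\<dots> = zeta d"
    proof (cases "a = 0")
      case True
      hence "d = 1" using ad by (simp add: cong_def)
      thus ?thesis using True by (simp add: zeta_def)
    next
      case False
      hence "d dvd a - 1" using cong_to_1_nat[OF ad] by simp
      hence "zeta d ^ (a - 1) = 1" using zeta_power_eq_1_iff[OF d(1)] by simp
      thus ?thesis using False by (metis mult_1 power_minus_mult neq0_conv)
    qed
    finally show ?thesis .
  qed
  ultimately have "of_int N * ?z ^ a = of_int N * ?z" using N(2) by (simp add: F)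
  hence za: "?z ^ a = ?z" using N(1) by (metis mult_cancel_left of_int_eq_0_iff)
  show ?thesis
  proof (cases "a = 0")
    case True
    hence "?z ^ 1 = 1" using za by simp
    hence "m = 1" using zeta_power_eq_1_iff[OF m, of 1] by simp
    thus ?thesis by simp
  next
    case False
    hence "?z ^ (a - 1) * ?z = ?z" using za by (metis power_minus_mult neq0_conv)
    hence "?z ^ (a - 1) = 1" by simp
    hence "m dvd a - 1" using zeta_power_eq_1_iff[OF m] by simp
    then obtain c where "a - 1 = m * c" by (rule dvdE)
    hence "a = 1 + m * c" using False by simp
    thus ?thesis unfolding cong_def by (simp only: mod_mult_self2)
  qed
qed

text \<open>Every \<open>1 + d * t\<close> with \<open>t\<close> not divisible by \<open>p\<close> has a factor in common with \<open>p\<close>, since otherwise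
  it would be \<open>1\<close> modulo \<open>d * p\<close>.  Comparing \<open>t = 1\<close> and \<open>t = 2\<close> leaves only \<open>p = 2\<close>.\<close>
lemma zeta_prime_extension:
  assumes d: "d > 0" and p: "Factorial_Ring.prime (p::nat)" and mem: "zeta (d * p) \<in> rat_adjoin {zeta d}"
  shows "p = 2 \<and> odd d"
proof -
  have p1: "p > 1" using p prime_gt_1_nat by simp
  have no: "\<not> coprime (1 + d * t) p" if "\<not> p dvd t" for t
  proof
    assume c: "coprime (1 + d * t) p"
    have "coprime (1 + d * t) d" by (rule coprimeI) (metis dvd_add_left_iff dvd_mult2)
    hence "coprime (1 + d * t) (d * p)" using c by simp
    moreover have "[1 + d * t = 1] (mod d)" unfolding cong_def by (rule mod_mult_self2)
    ultimately have "[1 + d * t = 1] (mod d * p)"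
      using zeta_fixed_by_galois[OF _ _ mem] d p1 by simp
    hence "d * p dvd d * t" using cong_to_1_nat by fastforce
    thus False using that d by simp
  qed
  have pd: "p dvd 1 + d * t" if "\<not> p dvd t" for t
    using no[OF that] p by (metis coprime_commute prime_imp_coprime)
  have "\<not> p dvd 1" using p1 by simp
  hence p1': "p dvd 1 + d * 1" by (intro pd)
  have "p dvd 2"
  proof (rule ccontr)
    assume "\<not> p dvd 2"
    hence "p dvd 1 + d * 2" by (rule pd)
    hence "p dvd (1 + d * 2) - (1 + d * 1)" using p1' by (rule dvd_diff_nat)
    hence "p dvd d" by simp
    thus False using p1' p1 by (metis dvd_add_left_iff mult_1_right nat_dvd_1_iff_1 less_irrefl)
  qed
  hence "p = 2" by (rule primes_dvd_imp_eq[OF p two_is_prime_nat])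
  thus ?thesis using p1' by auto
qed

text \<open>With \<open>m = lcm a b\<close> the numbers \<open>m / a\<close> and \<open>m / b\<close> are coprime, so a Bezout relation between them
  writes \<open>\<zeta>\<^sub>m\<close> as a product of powers of \<open>\<zeta>\<^sub>a\<close> and \<open>\<zeta>\<^sub>b\<close>.\<close>
lemma zeta_lcm_mem:
  assumes a: "a > 0" and b: "b > 0" and A: "zeta a \<in> rat_adjoin S" and B: "zeta b \<in> rat_adjoin S"
  shows "zeta (lcm a b) \<in> rat_adjoin S"
proof -
  define m where "m = lcm a b"
  have m: "m > 0" using a b by (simp add: m_def lcm_pos_nat)
  obtain x where x: "m = a * x" unfolding m_def by (meson dvdE dvd_lcm1)
  obtain y where y: "m = b * y" unfolding m_def by (meson dvdE dvd_lcm2)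
  have xy: "x > 0" "y > 0" using m x y by (metis mult_0_right neq0_conv)+
  have "coprime x y"
  proof (rule coprimeI)
    fix c assume c: "c dvd x" "c dvd y"
    then obtain x' y' where c': "x = c * x'" "y = c * y'" by blast
    have c0: "c > 0" using xy c by (auto intro: Nat.gr0I)
    have "a * x' = b * y'" using x y c' c0 by (metis mult.left_commute mult_cancel_left neq0_conv)
    hence "m dvd a * x'" unfolding m_def by (intro lcm_least) (metis dvd_triv_left)+
    hence "a * (c * x') dvd a * x'" using x c' by simp
    thus "is_unit c" using a xy c' by simp
  qed
  hence "gcd (int x) (int y) = 1" by simp
  then obtain u v where uv: "u * int x + v * int y = 1" using bezout_int[of "int x" "int y"] by metis
  have "zeta m = zeta m powi (u * int x + v * int y)" by (simp add: uv)
  also have "\<dots> = (zeta m ^ x) powi u * (zeta m ^ y) powi v"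
    by (simp add: power_int_add power_int_mult[symmetric] mult.commute[of _ "int _"] flip: power_int_of_nat)
  also have "zeta m ^ x = zeta a" using x xy zeta_mult_power by simp
  also have "zeta m ^ y = zeta b" using y xy zeta_mult_power by simp
  finally show ?thesis unfolding m_def[symmetric]
    using A B by (simp add: rat_adjoin_closed rat_adjoin_power_int)
qed

text \<open>Each prime factor of \<open>k\<close> is 2 by the prime case, applied to \<open>\<rat>(\<zeta>\<^sub>d)\<close>; a factor 4 is impossible by the
  prime case applied to \<open>\<rat>(\<zeta>\<^sub>2\<^sub>d)\<close>.\<close>
lemma zeta_extension:
  assumes d: "d > 0" and k: "k > 0" and mem: "zeta (d * k) \<in> rat_adjoin {zeta d}"
  shows "k = 1 \<or> (k = 2 \<and> odd d)"
proof -
  have sub: "zeta (d * j) \<in> rat_adjoin {zeta d}" if jk: "j dvd k" for j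
  proof -
    obtain i where i: "k = j * i" using jk by (rule dvdE)
    hence "zeta (d * j) = zeta (d * k) ^ i" using zeta_mult_power[of i "d * j"] k by (auto simp: mult.assoc)
    thus ?thesis using mem rat_adjoin_power by simp
  qed
  have two: "p = 2 \<and> odd d" if "Factorial_Ring.prime p" "p dvd k" for p
    using zeta_prime_extension[OF d that(1) sub[OF that(2)]] .
  have n4: "\<not> 4 dvd k"
  proof
    assume "4 dvd k"
    hence "zeta (d * 4) \<in> rat_adjoin {zeta d}" by (rule sub)
    moreover have "rat_adjoin {zeta d} \<subseteq> rat_adjoin {zeta (d * 2)}"
      using zeta_mult_power[of 2 d] rat_adjoin_power[OF rat_adjoin_closed(2), of "zeta (d * 2)" "{zeta (d * 2)}" 2]
      by (intro rat_adjoin_subset) simp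
    moreover have "d * 2 * 2 = d * 4" by simp
    ultimately have "zeta (d * 2 * 2) \<in> rat_adjoin {zeta (d * 2)}" by (metis subsetD)
    thus False using zeta_prime_extension[of "d * 2" 2] d by simp
  qed
  show ?thesis
  proof (cases "k = 1")
    case False
    then obtain p where "Factorial_Ring.prime p" "p dvd k" using prime_factor_nat by blast
    hence odd: "odd d" and "2 dvd k" using two by auto
    then obtain j where j: "k = 2 * j" by blast
    have "j = 1"
    proof (rule ccontr)
      assume "j \<noteq> 1"
      then obtain r where r: "Factorial_Ring.prime r" "r dvd j" using prime_factor_nat by blast
      hence "r = 2" using two[of r] j by simp
      thus False using n4 r j by auto
    qed
    thus ?thesis using j odd by simp
  qed simp
qed

text \<open>If the fields agree, they contain \<open>\<zeta>\<close> of the least common multiple of \<open>a\<close> and \<open>b\<close>, which can thus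
  be at most the double of each.  Conversely \<open>\<zeta>\<^sub>2\<^sub>a\<close> is minus a power of \<open>\<zeta>\<^sub>a\<close> for odd \<open>a\<close>.\<close>
lemma rat_adjoin_zeta_eq_iff:
  assumes a: "a > 0" and b: "b > 0"
  shows "rat_adjoin {zeta a} = rat_adjoin {zeta b} \<longleftrightarrow> a = b \<or> (odd a \<and> b = 2 * a) \<or> (odd b \<and> a = 2 * b)"
proof
  assume eq: "rat_adjoin {zeta a} = rat_adjoin {zeta b}"
  have "zeta a \<in> rat_adjoin {zeta a}" "zeta b \<in> rat_adjoin {zeta a}"
    using eq by (auto intro: rat_adjoin_closed)
  hence mem: "zeta (lcm a b) \<in> rat_adjoin {zeta a}" by (rule zeta_lcm_mem[OF a b])
  obtain x where x: "lcm a b = a * x" by (meson dvdE dvd_lcm1)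
  obtain y where y: "lcm a b = b * y" by (meson dvdE dvd_lcm2)
  have "lcm a b > 0" using a b by (simp add: lcm_pos_nat)
  hence xy: "x > 0" "y > 0" using x y by (metis mult_0_right neq0_conv)+
  have X: "x = 1 \<or> (x = 2 \<and> odd a)" using zeta_extension[OF a xy(1)] mem x by simp
  have Y: "y = 1 \<or> (y = 2 \<and> odd b)" using zeta_extension[OF b xy(2)] mem y eq by simp
  have "\<not> (x = 2 \<and> y = 2)"
  proof
    assume "x = 2 \<and> y = 2"
    hence "a = b" "lcm a b = 2 * a" using x y by auto
    thus False using a by simp
  qed
  thus "a = b \<or> (odd a \<and> b = 2 * a) \<or> (odd b \<and> a = 2 * b)"
    using X Y x y by auto
next
  have odd: "rat_adjoin {zeta a} = rat_adjoin {zeta (2 * a)}" if "odd a" "a > 0" for a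
  proof
    have "zeta (2 * a) ^ 2 = zeta a" using zeta_mult_power[of 2 a] by (simp add: mult.commute)
    thus "rat_adjoin {zeta a} \<subseteq> rat_adjoin {zeta (2 * a)}"
      using rat_adjoin_power[OF rat_adjoin_closed(2), of "zeta (2 * a)" "{zeta (2 * a)}" 2]
      by (intro rat_adjoin_subset) simp
    obtain k where k: "a = 2 * k + 1" using \<open>odd a\<close> by (auto elim: oddE)
    have "- (zeta a ^ (k + 1)) = cis pi * cis (2 * pi * real (k + 1) / real a)"
      by (simp only: zeta_power cis_pi) simp
    also have "\<dots> = cis (pi + 2 * pi * real (k + 1) / real a)" by (simp only: cis_mult)
    also have "pi + 2 * pi * real (k + 1) / real a = 2 * pi + 2 * pi / real (2 * a)"
      unfolding k by (simp add: field_simps)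
    also have "cis \<dots> = zeta (2 * a)" by (simp add: zeta_def cis_mult[symmetric])
    finally have "zeta (2 * a) = - (zeta a ^ (k + 1))" by simp
    moreover have "- (zeta a ^ (k + 1)) \<in> rat_adjoin {zeta a}"
      by (intro rat_adjoin_closed(3) rat_adjoin_power rat_adjoin_closed(2)) simp
    ultimately show "rat_adjoin {zeta (2 * a)} \<subseteq> rat_adjoin {zeta a}"
      by (intro rat_adjoin_subset) simp
  qed
  assume "a = b \<or> (odd a \<and> b = 2 * a) \<or> (odd b \<and> a = 2 * b)"
  thus "rat_adjoin {zeta a} = rat_adjoin {zeta b}" using odd a b by auto
qed

section \<open>Primitive roots of unity\<close>

definition prim_root :: "nat \<Rightarrow> 'a :: field \<Rightarrow> bool" where
  "prim_root e x \<longleftrightarrow> x ^ e = 1 \<and> (\<forall>k. x ^ k = 1 \<longrightarrow> e dvd k)"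

lemma prim_root_eq_1_iff: "prim_root e x \<Longrightarrow> x ^ k = 1 \<longleftrightarrow> e dvd k"
  by (auto simp: prim_root_def power_mult)

lemma prim_root_zeta: "e > 0 \<Longrightarrow> prim_root e (zeta e)"
  by (simp add: prim_root_def zeta_power_eq_1_iff)

lemma prim_root_power_eq_iff:
  assumes x: "prim_root e x" and e: "e > 0"
  shows "x ^ a = x ^ b \<longleftrightarrow> [a = b] (mod e)"
proof -
  have x0: "x \<noteq> 0" using x e by (auto simp: prim_root_def power_0_left)
  have *: "x ^ a = x ^ b \<Longrightarrow> a \<le> b \<Longrightarrow> [a = b] (mod e)" for a b
  proof -
    assume ab: "x ^ a = x ^ b" "a \<le> b"
    have "x ^ (b - a) * x ^ a = x ^ b" using ab(2) by (simp flip: power_add)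
    hence "x ^ (b - a) = 1" using x0 ab(1) by simp
    hence "e dvd b - a" using x prim_root_eq_1_iff by blast
    thus ?thesis using ab(2) by (metis cong_sym cong_altdef_nat)
  qed
  show ?thesis
  proof
    assume "x ^ a = x ^ b"
    thus "[a = b] (mod e)" using *[of a b] *[of b a] by (cases "a \<le> b") (auto simp: cong_sym)
  next
    assume "[a = b] (mod e)"
    thus "x ^ a = x ^ b" using power_mod_eq[of x e] x by (metis cong_def prim_root_def)
  qed
qed

lemma finite_card_roots_of_unity:
  assumes "k > 0"
  shows "finite {x :: 'a :: field. x ^ k = 1}" "card {x :: 'a :: field. x ^ k = 1} \<le> k"
proof -
  define p where "p = (Polynomial.monom 1 k - 1 :: 'a poly)"
  have "poly.coeff p k = 1" using assms by (simp add: p_def)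
  hence p: "p \<noteq> 0" by auto
  have roots: "{x. poly p x = 0} = {x. x ^ k = 1}" by (simp add: p_def poly_monom)
  show "finite {x :: 'a. x ^ k = 1}" using poly_roots_finite[OF p] by (simp add: roots)
  have "card {x :: 'a. x ^ k = 1} \<le> Polynomial.degree p" using card_poly_roots_bound[OF p] by (simp add: roots)
  also have "Polynomial.degree p \<le> k" unfolding p_def
    by (intro degree_diff_le) (auto simp: degree_monom_le)
  finally show "card {x :: 'a. x ^ k = 1} \<le> k" .
qed

text \<open>The \<open>e\<close> distinct powers of \<open>x\<close> exhaust the at most \<open>e\<close> roots of \<open>X\<^sup>e - 1\<close>.\<close>
lemma prim_root_powers:
  assumes x: "prim_root e x" and e: "e > 0" and y: "y ^ e = 1"
  shows "\<exists>k. y = x ^ k"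
proof -
  have "inj_on (\<lambda>k. x ^ k) {..<e}"
    by (auto simp: inj_on_def prim_root_power_eq_iff[OF x e] cong_def)
  hence "card ((\<lambda>k. x ^ k) ` {..<e}) = e" by (simp add: card_image)
  moreover have "(\<lambda>k. x ^ k) ` {..<e} \<subseteq> {y. y ^ e = 1}"
    using x by (auto simp: prim_root_eq_1_iff simp flip: power_mult)
  ultimately have "(\<lambda>k. x ^ k) ` {..<e} = {y. y ^ e = 1}"
    using finite_card_roots_of_unity[OF e, where 'a = 'a] by (intro card_seteq) auto
  thus ?thesis using y by blast
qed

lemma prim_root_mult_coprime:
  assumes x: "prim_root a x" and y: "prim_root b y" and c: "coprime a b"
  shows "prim_root (a * b) (x * y)"
  unfolding prim_root_def
proof (intro conjI allI impI)
  have "(x * y) ^ (a * b) = (x ^ a) ^ b * (y ^ b) ^ a"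
    by (simp add: power_mult_distrib mult.commute flip: power_mult)
  thus "(x * y) ^ (a * b) = 1" using x y by (simp add: prim_root_def)
next
  fix k assume k: "(x * y) ^ k = 1"
  have "x ^ (k * b) * (y ^ b) ^ k = ((x * y) ^ k) ^ b"
    by (simp add: power_mult_distrib mult.commute flip: power_mult)
  hence "x ^ (k * b) = 1" using k y by (simp add: prim_root_def)
  hence "a dvd k" using x c by (simp add: prim_root_eq_1_iff coprime_dvd_mult_left_iff)
  moreover have "y ^ (k * a) * (x ^ a) ^ k = ((x * y) ^ k) ^ a"
    by (simp add: power_mult_distrib mult.commute flip: power_mult)
  hence "y ^ (k * a) = 1" using k x by (simp add: prim_root_def)
  hence "b dvd k" using y c by (simp add: prim_root_eq_1_iff coprime_dvd_mult_left_iff coprime_commute)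
  ultimately show "a * b dvd k" using c by (simp add: divides_mult)
qed

text \<open>By adding one prime factor \<open>p\<close> at a time.  If \<open>p\<close> already divides \<open>e\<close>, a \<open>p\<close>-th root of a primitive
  \<open>e\<close>-th root has order \<open>p * e\<close>.  Otherwise a root of \<open>1 + X + \<dots> + X\<^sup>p\<^sup>-\<^sup>1\<close>, which differs from 1
  because \<open>p \<noteq> 0\<close> in the field, has order \<open>p\<close> and contributes a coprime factor.\<close>
lemma prim_root_exists:
  assumes "e > 0" "of_nat e \<noteq> (0 :: 'a :: alg_closed_field)"
  shows "\<exists>x :: 'a. prim_root e x"
  using assms
proof (induction e rule: prime_divisors_induct)
  case zero thus ?case by simp
next
  case (unit e)
  thus ?case by (intro exI[of _ 1]) (simp add: prim_root_def)
next
  case (factor p e)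
  have p1: "p > 1" using factor prime_gt_1_nat by simp
  have "e > 0" "of_nat e \<noteq> (0 :: 'a)" and p0: "of_nat p \<noteq> (0 :: 'a)"
    using factor.prems by (auto intro: Nat.gr0I)
  then obtain x :: 'a where x: "prim_root e x" using factor.IH by blast
  show ?case
  proof (cases "p dvd e")
    case True
    then obtain e' where e': "e = p * e'" by blast
    obtain y where y: "y ^ p = x" using nth_root_exists[of p x] p1 by auto
    have "prim_root (p * e) y" unfolding prim_root_def
    proof (intro conjI allI impI)
      show "y ^ (p * e) = 1" using x y by (simp add: power_mult prim_root_def)
    next
      fix k assume k: "y ^ k = 1"
      have "x ^ k = (y ^ k) ^ p" unfolding y[symmetric] by (simp add: mult.commute flip: power_mult)
      hence "e dvd k" using k x by (simp add: prim_root_eq_1_iff)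
      then obtain j where j: "k = e * j" by blast
      have "y ^ k = x ^ (e' * j)" unfolding y[symmetric] j e' by (simp add: mult.assoc flip: power_mult)
      hence "e dvd e' * j" using k x by (simp add: prim_root_eq_1_iff)
      hence "p dvd j" using \<open>e > 0\<close> unfolding e' by simp
      thus "p * e dvd k" unfolding j by simp
    qed
    thus ?thesis by blast
  next
    case False
    define f where "f = (\<Sum>i<p. Polynomial.monom 1 i :: 'a poly)"
    have ev: "poly f w = (\<Sum>i<p. w ^ i)" for w by (simp add: f_def poly_sum poly_monom)
    have "poly.coeff f (p - 1) = 1" using p1 by (simp add: f_def coeff_sum)
    hence "Polynomial.degree f > 0" using p1 by (metis le_degree zero_less_diff less_le_trans zero_neq_one)
    then obtain w where "poly f w = 0" using alg_closed_imp_poly_has_root by blast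
    hence w: "(\<Sum>i<p. w ^ i) = 0" by (simp add: ev)
    have w1: "w \<noteq> 1" using w p0 by auto
    have wp: "w ^ p = 1" using w power_diff_1_eq[of w p] by simp
    have "prim_root p w" unfolding prim_root_def
    proof (intro conjI allI impI)
      fix k assume k: "w ^ k = 1"
      show "p dvd k"
      proof (rule ccontr)
        assume "\<not> p dvd k"
        hence "coprime p k" using factor by (simp add: prime_imp_coprime)
        hence gcd: "gcd k p = 1" by (metis coprime_iff_gcd_eq_1 gcd.commute)
        have "k \<noteq> 0" using \<open>\<not> p dvd k\<close> by (metis dvd_0_right)
        then obtain u v where "k * u = p * v + 1"
          using bezout_nat[of k p] gcd by metis
        hence "w ^ (k * u) = w ^ (p * v + 1)" by (rule arg_cong)
        hence "(w ^ k) ^ u = (w ^ p) ^ v * w" by (simp add: power_mult)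
        thus False using k wp w1 by simp
      qed
    qed (rule wp)
    moreover have "coprime p e" using False factor by (simp add: prime_imp_coprime)
    ultimately show ?thesis using x prim_root_mult_coprime by blast
  qed
qed

text \<open>Multiplication by \<open>c\<close> permutes \<open>S\<close>; compare the product over \<open>S\<close> before and after.  This is the
  proof of Fermat's little theorem, usable for any set stable under \<open>c\<close>.\<close>
lemma power_card_eq_1_of_stable:
  fixes c :: "'a :: field"
  assumes S: "finite S" "0 \<notin> S" and c: "c \<noteq> 0" and st: "\<And>x. x \<in> S \<Longrightarrow> c * x \<in> S"
  shows "c ^ card S = 1"
proof -
  have inj: "inj_on ((*) c) S" using c by (simp add: inj_on_def)
  have "(*) c ` S = S" using st S inj by (intro endo_inj_surj) auto
  hence "prod (\<lambda>x. x) S = prod (\<lambda>x. x) ((*) c ` S)" by simp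
  also have "\<dots> = (\<Prod>x\<in>S. c * x)" by (subst prod.reindex[OF inj]) simp
  also have "\<dots> = c ^ card S * prod (\<lambda>x. x) S" by (simp add: prod.distrib)
  finally show ?thesis using S by (simp add: prod_zero_iff)
qed

section \<open>Characters of a finite abelian group\<close>

text \<open>Characters are extensional, so that they are determined by their values on the carrier.\<close>
definition chars :: "('g, 'b) monoid_scheme \<Rightarrow> ('g \<Rightarrow> 'k :: field) set" where
  "chars G = {\<chi> \<in> extensional (carrier G). (\<forall>g\<in>carrier G. \<chi> g \<noteq> 0) \<and>
     (\<forall>g\<in>carrier G. \<forall>h\<in>carrier G. \<chi> (g \<otimes>\<^bsub>G\<^esub> h) = \<chi> g * \<chi> h)}"

text \<open>The order of \<open>\<chi>\<close> in the character group, which is also the exponent of the group of its values.\<close>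
definition char_order :: "('g, 'b) monoid_scheme \<Rightarrow> ('g \<Rightarrow> 'k :: field) \<Rightarrow> nat" where
  "char_order G \<chi> = (LEAST m. m > 0 \<and> (\<forall>g\<in>carrier G. \<chi> g ^ m = 1))"

locale finite_abelian_group = comm_group G for G (structure) +
  assumes fin: "finite (carrier G)"
begin

lemma exponent_exists: "Coset.order G > 0" "\<And>x. x \<in> carrier G \<Longrightarrow> x [^] Coset.order G = \<one>"
  using fin one_closed order_gt_0_iff_finite by (auto intro: pow_order_eq_1)

lemma exponent:
  shows exponent_pos: "group_exponent G > 0"
    and pow_exponent: "x \<in> carrier G \<Longrightarrow> x [^] group_exponent G = \<one>"
proof -
  have "group_exponent G > 0 \<and> (\<forall>x\<in>carrier G. x [^] group_exponent G = \<one>)"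
    unfolding group_exponent_def by (rule LeastI[of _ "Coset.order G"]) (use exponent_exists in auto)
  thus "group_exponent G > 0" "x \<in> carrier G \<Longrightarrow> x [^] group_exponent G = \<one>" by auto
qed

lemma exponent_dvd:
  assumes "\<And>x. x \<in> carrier G \<Longrightarrow> x [^] n = \<one>"
  shows "group_exponent G dvd n"
proof (rule ccontr)
  let ?e = "group_exponent G"
  assume "\<not> ?e dvd n"
  hence r: "n mod ?e > 0" by (simp add: mod_greater_zero_iff_not_dvd)
  have "x [^] (n mod ?e) = \<one>" if x: "x \<in> carrier G" for x
  proof -
    have "x [^] n = (x [^] ?e) [^] (n div ?e) \<otimes> x [^] (n mod ?e)"
      using x by (simp add: nat_pow_pow nat_pow_mult)
    thus ?thesis using assms[OF x] pow_exponent[OF x] x by simp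
  qed
  hence "?e \<le> n mod ?e" unfolding group_exponent_def using r
    by (intro Least_le) (auto simp: group_exponent_def)
  thus False using mod_less_divisor[OF exponent_pos, of n] by linarith
qed

lemma exponent_dvd_order: "group_exponent G dvd Coset.order G"
  by (rule exponent_dvd) (rule exponent_exists)

lemma chars_mult: "\<chi> \<in> chars G \<Longrightarrow> g \<in> carrier G \<Longrightarrow> h \<in> carrier G \<Longrightarrow> \<chi> (g \<otimes> h) = \<chi> g * \<chi> h"
  and chars_nonzero: "\<chi> \<in> chars G \<Longrightarrow> g \<in> carrier G \<Longrightarrow> \<chi> g \<noteq> 0"
  and chars_extensional: "\<chi> \<in> chars G \<Longrightarrow> \<chi> \<in> extensional (carrier G)"
  by (auto simp: chars_def)

lemma chars_one: "\<chi> \<in> chars G \<Longrightarrow> \<chi> \<one> = 1"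
  using chars_mult[of \<chi> \<one> \<one>] chars_nonzero[of \<chi> \<one>] by simp

lemma chars_pow: "\<chi> \<in> chars G \<Longrightarrow> g \<in> carrier G \<Longrightarrow> \<chi> (g [^] (k::nat)) = \<chi> g ^ k"
  by (induction k) (simp_all add: chars_one chars_mult)

lemma chars_inv: "\<chi> \<in> chars G \<Longrightarrow> g \<in> carrier G \<Longrightarrow> \<chi> (inv g) = inverse (\<chi> g)"
  using chars_mult[of \<chi> g "inv g"] by (simp add: chars_one inverse_unique)

lemma chars_exponent: "\<chi> \<in> chars G \<Longrightarrow> g \<in> carrier G \<Longrightarrow> \<chi> g ^ group_exponent G = 1"
  using chars_pow[of \<chi> g "group_exponent G"] by (simp add: pow_exponent chars_one)

lemma char_order:
  assumes "\<chi> \<in> chars G"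
  shows char_order_pos: "char_order G \<chi> > 0"
    and char_order_power: "g \<in> carrier G \<Longrightarrow> \<chi> g ^ char_order G \<chi> = 1"
proof -
  have "char_order G \<chi> > 0 \<and> (\<forall>g\<in>carrier G. \<chi> g ^ char_order G \<chi> = 1)"
    unfolding char_order_def
    by (rule LeastI[of _ "group_exponent G"]) (use chars_exponent[OF assms] exponent_pos in auto)
  thus "char_order G \<chi> > 0" "g \<in> carrier G \<Longrightarrow> \<chi> g ^ char_order G \<chi> = 1" by auto
qed

lemma char_order_dvd_iff:
  assumes \<chi>: "\<chi> \<in> chars G"
  shows "char_order G \<chi> dvd n \<longleftrightarrow> (\<forall>g\<in>carrier G. \<chi> g ^ n = 1)"
proof
  assume "char_order G \<chi> dvd n"
  thus "\<forall>g\<in>carrier G. \<chi> g ^ n = 1" using char_order_power[OF \<chi>] by (auto simp: power_mult)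
next
  assume n: "\<forall>g\<in>carrier G. \<chi> g ^ n = 1"
  let ?e = "char_order G \<chi>"
  show "?e dvd n"
  proof (rule ccontr)
    assume "\<not> ?e dvd n"
    hence r: "n mod ?e > 0" by (simp add: mod_greater_zero_iff_not_dvd)
    have "\<chi> g ^ (n mod ?e) = 1" if g: "g \<in> carrier G" for g
    proof -
      have "\<chi> g ^ n = (\<chi> g ^ ?e) ^ (n div ?e) * \<chi> g ^ (n mod ?e)"
        by (simp flip: power_mult power_add)
      thus ?thesis using n g char_order_power[OF \<chi> g] by simp
    qed
    hence "?e \<le> n mod ?e" unfolding char_order_def using r
      by (intro Least_le) (auto simp: char_order_def)
    thus False using mod_less_divisor[OF char_order_pos[OF \<chi>], of n] by linarith
  qed
qed

lemma char_order_dvd_exponent: "\<chi> \<in> chars G \<Longrightarrow> char_order G \<chi> dvd group_exponent G"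
  by (simp add: char_order_dvd_iff chars_exponent)

lemma finite_chars: "finite (chars G :: ('a \<Rightarrow> 'k :: field) set)"
proof (rule finite_subset)
  show "chars G \<subseteq> (carrier G \<rightarrow>\<^sub>E {x :: 'k. x ^ group_exponent G = 1})"
    using chars_exponent chars_extensional by (auto simp: PiE_def)
  show "finite (carrier G \<rightarrow>\<^sub>E {x :: 'k. x ^ group_exponent G = 1})"
    by (intro finite_PiE fin finite_card_roots_of_unity exponent_pos)
qed

text \<open>Translation by \<open>h\<close> multiplies the sum by \<open>f h\<close>.\<close>
lemma sum_char_eq_0:
  fixes f :: "'a \<Rightarrow> 'k :: field"
  assumes mult: "\<And>g h. g \<in> carrier G \<Longrightarrow> h \<in> carrier G \<Longrightarrow> f (g \<otimes> h) = f g * f h"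
    and h: "h \<in> carrier G" "f h \<noteq> 1"
  shows "(\<Sum>g\<in>carrier G. f g) = 0"
proof -
  have "bij_betw (\<lambda>g. h \<otimes> g) (carrier G) (carrier G)"
    using h by (intro bij_betw_byWitness[where f' = "\<lambda>g. inv h \<otimes> g"]) (auto simp: m_assoc[symmetric])
  hence "(\<Sum>g\<in>carrier G. f g) = (\<Sum>g\<in>carrier G. f (h \<otimes> g))"
    by (rule sum.reindex_bij_betw[symmetric])
  also have "\<dots> = f h * (\<Sum>g\<in>carrier G. f g)"
    using h by (simp add: mult sum_distrib_left)
  finally have "(1 - f h) * (\<Sum>g\<in>carrier G. f g) = 0" by (simp add: algebra_simps)
  thus ?thesis using h by simp
qed

text \<open>Values of characters are powers of the primitive root \<open>x\<close>; replacing \<open>x\<close> by \<open>y\<close> is an isomorphism of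
  the groups of \<open>e\<close>-th roots of unity.\<close>
lemma chars_transfer:
  fixes x :: "'k :: field" and y :: "'l :: field"
  assumes x: "prim_root (group_exponent G) x" and y: "prim_root (group_exponent G) y"
  shows "\<exists>T :: ('a \<Rightarrow> 'k) \<Rightarrow> ('a \<Rightarrow> 'l). inj_on T (chars G) \<and>
    (\<forall>\<chi>\<in>chars G. T \<chi> \<in> chars G \<and> char_order G (T \<chi>) = char_order G \<chi>)"
proof -
  let ?e = "group_exponent G"
  define lg where "lg u = (SOME k. u = x ^ k)" for u
  have lg: "u = x ^ lg u" if "u ^ ?e = 1" for u
    unfolding lg_def by (rule someI_ex) (rule prim_root_powers[OF x exponent_pos that])
  define T where "T \<chi> = restrict (\<lambda>g. y ^ lg (\<chi> g)) (carrier G)" for \<chi>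
  have pow_iff: "x ^ a = x ^ b \<longleftrightarrow> y ^ a = y ^ b" for a b
    by (simp add: prim_root_power_eq_iff[OF x exponent_pos] prim_root_power_eq_iff[OF y exponent_pos])
  have y0: "y \<noteq> 0" using y exponent_pos by (auto simp: prim_root_def power_0_left)
  have \<chi>lg: "\<chi> g = x ^ lg (\<chi> g)" if "\<chi> \<in> chars G" "g \<in> carrier G" for \<chi> g
    using lg chars_exponent that by blast
  have T: "T \<chi> \<in> chars G" if \<chi>: "\<chi> \<in> chars G" for \<chi>
  proof -
    have "y ^ lg (\<chi> (g \<otimes> h)) = y ^ lg (\<chi> g) * y ^ lg (\<chi> h)" if "g \<in> carrier G" "h \<in> carrier G" for g h
    proof -
      have "x ^ lg (\<chi> (g \<otimes> h)) = x ^ (lg (\<chi> g) + lg (\<chi> h))"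
        using that by (simp add: power_add chars_mult[OF \<chi>] flip: \<chi>lg[OF \<chi>]) (metis \<chi>lg[OF \<chi>] chars_mult[OF \<chi>] m_closed)
      hence "y ^ lg (\<chi> (g \<otimes> h)) = y ^ (lg (\<chi> g) + lg (\<chi> h))" by (simp only: pow_iff)
      thus ?thesis by (simp only: power_add)
    qed
    thus ?thesis using y0 by (simp add: chars_def T_def)
  qed
  have "T \<chi> g ^ n = 1 \<longleftrightarrow> \<chi> g ^ n = 1" if "\<chi> \<in> chars G" "g \<in> carrier G" for \<chi> g n
  proof -
    have "T \<chi> g ^ n = 1 \<longleftrightarrow> y ^ (lg (\<chi> g) * n) = y ^ 0" using that by (simp add: T_def power_mult)
    also have "\<dots> \<longleftrightarrow> x ^ (lg (\<chi> g) * n) = x ^ 0" by (simp only: pow_iff)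
    also have "\<dots> \<longleftrightarrow> \<chi> g ^ n = 1" by (simp add: power_mult flip: \<chi>lg[OF that])
    finally show ?thesis .
  qed
  hence "char_order G (T \<chi>) = char_order G \<chi>" if "\<chi> \<in> chars G" for \<chi>
    using that by (simp add: char_order_def cong: conj_cong ball_cong)
  moreover have "inj_on T (chars G)"
  proof (rule inj_onI)
    fix \<chi> \<psi> assume *: "\<chi> \<in> chars G" "\<psi> \<in> chars G" "T \<chi> = T \<psi>"
    show "\<chi> = \<psi>"
    proof (rule extensionalityI[OF chars_extensional[OF *(1)] chars_extensional[OF *(2)]])
      fix g assume g: "g \<in> carrier G"
      have "y ^ lg (\<chi> g) = y ^ lg (\<psi> g)" using fun_cong[OF *(3), of g] g by (simp add: T_def)
      thus "\<chi> g = \<psi> g" using \<chi>lg[OF *(1) g] \<chi>lg[OF *(2) g] pow_iff by metis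
    qed
  qed
  ultimately show ?thesis using T by (intro exI[of _ T]) simp
qed

lemma card_chars_le:
  fixes x :: "'k :: field" and y :: "'l :: field"
  assumes x: "prim_root (group_exponent G) x" and y: "prim_root (group_exponent G) y"
  shows "card {\<chi> :: 'a \<Rightarrow> 'k. \<chi> \<in> chars G \<and> P (char_order G \<chi>)} \<le>
         card {\<chi> :: 'a \<Rightarrow> 'l. \<chi> \<in> chars G \<and> P (char_order G \<chi>)}"
proof -
  obtain T :: "('a \<Rightarrow> 'k) \<Rightarrow> ('a \<Rightarrow> 'l)" where "inj_on T (chars G)"
    "\<forall>\<chi>\<in>chars G. T \<chi> \<in> chars G \<and> char_order G (T \<chi>) = char_order G \<chi>"
    using chars_transfer[OF x y] by blast
  thus ?thesis using finite_chars[where 'k = 'l]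
    by (intro card_inj_on_le[of T]) (auto simp: inj_on_def)
qed

lemma card_chars_eq:
  fixes x :: "'k :: field" and y :: "'l :: field"
  assumes x: "prim_root (group_exponent G) x" and y: "prim_root (group_exponent G) y"
  shows "card {\<chi> :: 'a \<Rightarrow> 'k. \<chi> \<in> chars G \<and> P (char_order G \<chi>)} =
         card {\<chi> :: 'a \<Rightarrow> 'l. \<chi> \<in> chars G \<and> P (char_order G \<chi>)}"
  by (rule antisym[OF card_chars_le[OF x y] card_chars_le[OF y x]])

text \<open>The image has some cardinality \<open>k\<close>, is stable under multiplication by each of its members, and so
  consists of \<open>k\<close>-th roots of unity, hence of all of them.\<close>
lemma char_image:
  assumes \<chi>: "(\<chi> :: 'a \<Rightarrow> complex) \<in> chars G"
  shows "\<chi> ` carrier G = {x. x ^ char_order G \<chi> = 1}"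
proof -
  define k where "k = card (\<chi> ` carrier G)"
  have k: "k > 0" unfolding k_def using fin one_closed by (auto simp: card_gt_0_iff)
  have "\<chi> ` carrier G \<subseteq> {x. x ^ k = 1}"
  proof safe
    fix g assume g: "g \<in> carrier G"
    show "\<chi> g ^ k = 1" unfolding k_def
    proof (rule power_card_eq_1_of_stable)
      fix x assume "x \<in> \<chi> ` carrier G"
      then obtain h where "h \<in> carrier G" "x = \<chi> h" by blast
      thus "\<chi> g * x \<in> \<chi> ` carrier G" using g chars_mult[OF \<chi> g, symmetric] by auto
    qed (use fin chars_nonzero[OF \<chi>] g in auto)
  qed
  hence im: "\<chi> ` carrier G = {x. x ^ k = 1}"
    using finite_card_roots_of_unity[OF k, where 'a = complex] by (intro card_seteq) (auto simp: k_def)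
  have "char_order G \<chi> dvd k" using im by (auto simp: char_order_dvd_iff[OF \<chi>])
  moreover have "zeta k \<in> \<chi> ` carrier G" using im zeta_power_self[OF k] by simp
  hence "zeta k ^ char_order G \<chi> = 1" using char_order_power[OF \<chi>] by auto
  hence "k dvd char_order G \<chi>" by (simp add: zeta_power_eq_1_iff[OF k])
  ultimately have "char_order G \<chi> = k" by (rule dvd_antisym)
  thus ?thesis using im by simp
qed

lemma character_field_eq:
  assumes \<chi>: "(\<chi> :: 'a \<Rightarrow> complex) \<in> chars G"
  shows "character_field G \<chi> = rat_adjoin {zeta (char_order G \<chi>)}"
proof -
  let ?m = "char_order G \<chi>"
  have m: "?m > 0" by (rule char_order_pos[OF \<chi>])
  have "{x. x ^ ?m = 1} \<subseteq> rat_adjoin {zeta ?m}"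
  proof safe
    fix x :: complex assume "x ^ ?m = 1"
    then obtain k where "x = zeta ?m ^ k" using prim_root_powers[OF prim_root_zeta[OF m] m] by blast
    thus "x \<in> rat_adjoin {zeta ?m}" by (simp add: rat_adjoin_power rat_adjoin_closed(2))
  qed
  moreover have "{zeta ?m} \<subseteq> rat_adjoin {x. x ^ ?m = 1}"
    using zeta_power_self[OF m] by (auto intro: rat_adjoin_closed)
  ultimately show ?thesis unfolding character_field_def char_image[OF \<chi>]
    by (intro equalityI rat_adjoin_subset)
qed

end

section \<open>Representations and semilinear functionals\<close>

lemma card_carrier_vec_finite:
  assumes "finite (UNIV :: 'f set)"
  shows "finite (carrier_vec n :: 'f vec set)" "card (carrier_vec n :: 'f vec set) = card (UNIV :: 'f set) ^ n"
proof -
  let ?E = "{..<n} \<rightarrow>\<^sub>E (UNIV :: 'f set)"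
  have "bij_betw (\<lambda>f. vec n f) ?E (carrier_vec n :: 'f vec set)"
  proof (rule bij_betw_byWitness[where f' = "\<lambda>v :: 'f vec. restrict (\<lambda>i. v $ i) {..<n}"])
    show "\<forall>f\<in>?E. restrict (\<lambda>i. vec n f $ i) {..<n} = f"
      by (auto simp: PiE_def intro!: extensionalityI[of _ "{..<n}"])
    show "\<forall>v\<in>carrier_vec n. vec n (restrict (\<lambda>i. v $ i) {..<n}) = (v :: 'f vec)"
    proof
      fix v :: "'f vec" assume "v \<in> carrier_vec n"
      thus "vec n (restrict (\<lambda>i. v $ i) {..<n}) = v" by (intro eq_vecI) simp_all
    qed
    show "(\<lambda>f. vec n f) ` ?E \<subseteq> (carrier_vec n :: 'f vec set)" by (rule image_subsetI) simp
    show "(\<lambda>v. restrict (\<lambda>i. v $ i) {..<n}) ` (carrier_vec n :: 'f vec set) \<subseteq> ?E"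
      by (rule image_subsetI) simp
  qed
  moreover have "finite ?E" using assms by (intro finite_PiE) auto
  moreover have "card ?E = card (UNIV :: 'f set) ^ n" by (simp add: card_PiE)
  ultimately show "finite (carrier_vec n :: 'f vec set)" "card (carrier_vec n :: 'f vec set) = card (UNIV :: 'f set) ^ n"
    by (auto simp: bij_betw_finite bij_betw_same_card)
qed

lemma mult_mat_unit_vec:
  fixes A :: "'f :: semiring_1 mat"
  assumes "A \<in> carrier_mat n n" "j < n" "i < n"
  shows "(A *\<^sub>v unit_vec n j) $ i = A $$ (i, j)"
proof -
  have "(A *\<^sub>v unit_vec n j) $ i = (\<Sum>k\<in>{0..<n}. A $$ (i, k) * (if k = j then 1 else 0))"
    using assms by (simp add: scalar_prod_def)
  also have "\<dots> = (\<Sum>k\<in>{0..<n}. if k = j then A $$ (i, k) else 0)"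
    by (intro sum.cong) auto
  finally show ?thesis using assms by simp
qed

lemma mat_eqI_mult_vec:
  assumes A: "A \<in> carrier_mat n n" and B: "B \<in> carrier_mat n n"
    and eq: "\<And>u. u \<in> carrier_vec n \<Longrightarrow> A *\<^sub>v u = B *\<^sub>v u"
  shows "A = (B :: 'f :: semiring_1 mat)"
proof (rule eq_matI)
  fix i j assume "i < dim_row B" "j < dim_col B"
  hence "i < n" "j < n" using B by auto
  thus "A $$ (i, j) = B $$ (i, j)"
    using mult_mat_unit_vec[OF A] mult_mat_unit_vec[OF B] eq[of "unit_vec n j"] by (metis unit_vec_carrier)
qed (use A B in auto)

lemma invariant_subspaceI:
  fixes W :: "'f :: field vec set"
  assumes "W \<subseteq> carrier_vec n" "0\<^sub>v n \<in> W" "\<And>u v. u \<in> W \<Longrightarrow> v \<in> W \<Longrightarrow> u + v \<in> W"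
    and "\<And>c u. u \<in> W \<Longrightarrow> c \<cdot>\<^sub>v u \<in> W"
    and "\<And>g w. g \<in> carrier G \<Longrightarrow> w \<in> W \<Longrightarrow> \<rho> g *\<^sub>v w \<in> W"
  shows "invariant_subspace G n \<rho> W"
  using assms vec_vs[where 'a = 'f] vec_module[where 'a = 'f]
  unfolding invariant_subspace_def subspace_def submodule_def
  by (auto simp: module_vec_simps)

lemma irreducible_repD:
  fixes W :: "'f :: field vec set"
  assumes "irreducible_rep G n \<rho>"
    and "W \<subseteq> carrier_vec n" "0\<^sub>v n \<in> W" "\<And>u v. u \<in> W \<Longrightarrow> v \<in> W \<Longrightarrow> u + v \<in> W"
    and "\<And>c u. u \<in> W \<Longrightarrow> c \<cdot>\<^sub>v u \<in> W"
    and "\<And>g w. g \<in> carrier G \<Longrightarrow> w \<in> W \<Longrightarrow> \<rho> g *\<^sub>v w \<in> W"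
  shows "W = {0\<^sub>v n} \<or> W = carrier_vec n"
  using assms(1) invariant_subspaceI[of W n G \<rho>, OF assms(2-6)] unfolding irreducible_rep_def by blast

lemma GL_carrier:
  "carrier (GL TYPE('f :: field) n) = {P \<in> carrier_mat n n. \<exists>Q\<in>carrier_mat n n. Q * P = 1\<^sub>m n \<and> P * Q = 1\<^sub>m n}"
  by (auto simp: GL_def units_of_def Units_def ring_mat_def)

lemma GL_group: "Group.group (GL TYPE('f :: field) n)"
proof -
  interpret R: ring "ring_mat TYPE('f) n ()" by (rule ring_mat)
  show ?thesis unfolding GL_def by (rule R.units_group)
qed

lemma GL_mult: "monoid.mult (GL TYPE('f :: field) n) = (*)" and GL_one: "monoid.one (GL TYPE('f :: field) n) = 1\<^sub>m n"
  by (simp_all add: GL_def units_of_def ring_mat_def)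

context finite_abelian_group
begin

lemma representation_iff:
  "representation G n (\<rho> :: 'a \<Rightarrow> 'f :: field mat) \<longleftrightarrow>
    (\<forall>g\<in>carrier G. \<rho> g \<in> carrier_mat n n) \<and> \<rho> \<one> = 1\<^sub>m n \<and>
    (\<forall>g\<in>carrier G. \<forall>h\<in>carrier G. \<rho> (g \<otimes> h) = \<rho> g * \<rho> h)"
proof
  assume "representation G n \<rho>"
  hence h: "\<rho> \<in> hom G (GL TYPE('f) n)" by (simp add: representation_def)
  interpret group_hom G "GL TYPE('f) n" \<rho>
    using h GL_group by (simp add: group_hom_def group_hom_axioms_def is_group)
  show "(\<forall>g\<in>carrier G. \<rho> g \<in> carrier_mat n n) \<and> \<rho> \<one> = 1\<^sub>m n \<and>
    (\<forall>g\<in>carrier G. \<forall>h\<in>carrier G. \<rho> (g \<otimes> h) = \<rho> g * \<rho> h)"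
    using hom_closed hom_one hom_mult by (auto simp: GL_carrier GL_mult GL_one)
next
  assume *: "(\<forall>g\<in>carrier G. \<rho> g \<in> carrier_mat n n) \<and> \<rho> \<one> = 1\<^sub>m n \<and>
    (\<forall>g\<in>carrier G. \<forall>h\<in>carrier G. \<rho> (g \<otimes> h) = \<rho> g * \<rho> h)"
  have "\<rho> g \<in> carrier (GL TYPE('f) n)" if "g \<in> carrier G" for g
  proof -
    have "\<rho> (inv g) * \<rho> g = 1\<^sub>m n" "\<rho> g * \<rho> (inv g) = 1\<^sub>m n"
      using * that by (metis inv_closed l_inv, metis inv_closed r_inv)
    thus ?thesis using * that by (auto simp: GL_carrier)
  qed
  thus "representation G n \<rho>" using * by (auto simp: representation_def hom_def GL_mult)
qed

lemma
  assumes "representation G n (\<rho> :: 'a \<Rightarrow> 'f :: field mat)"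
  shows rep_carrier: "g \<in> carrier G \<Longrightarrow> \<rho> g \<in> carrier_mat n n"
    and rep_vec: "g \<in> carrier G \<Longrightarrow> u \<in> carrier_vec n \<Longrightarrow> \<rho> g *\<^sub>v u \<in> carrier_vec n"
    and rep_one: "u \<in> carrier_vec n \<Longrightarrow> \<rho> \<one> *\<^sub>v u = u"
    and rep_mult: "g \<in> carrier G \<Longrightarrow> h \<in> carrier G \<Longrightarrow> u \<in> carrier_vec n \<Longrightarrow>
      \<rho> (g \<otimes> h) *\<^sub>v u = \<rho> g *\<^sub>v (\<rho> h *\<^sub>v u)"
  using assms unfolding representation_iff
  by (auto intro!: mult_mat_vec_carrier assoc_mult_mat_vec[of _ n n _ n])

end

context field_hom
begin

text \<open>These are the linear maps from the column space over the small field to the large field.  They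
  replace vectors over the large field: scalars may be extended without extending the representation.\<close>
definition semilinear :: "nat \<Rightarrow> ('a vec \<Rightarrow> 'b) \<Rightarrow> bool" where
  "semilinear n \<Lambda> \<longleftrightarrow>
     (\<forall>u\<in>carrier_vec n. \<forall>v\<in>carrier_vec n. \<Lambda> (u + v) = \<Lambda> u + \<Lambda> v) \<and>
     (\<forall>c. \<forall>u\<in>carrier_vec n. \<Lambda> (c \<cdot>\<^sub>v u) = hom c * \<Lambda> u)"

lemma
  assumes "semilinear n \<Lambda>"
  shows semilinear_add: "u \<in> carrier_vec n \<Longrightarrow> v \<in> carrier_vec n \<Longrightarrow> \<Lambda> (u + v) = \<Lambda> u + \<Lambda> v"
    and semilinear_smult: "u \<in> carrier_vec n \<Longrightarrow> \<Lambda> (c \<cdot>\<^sub>v u) = hom c * \<Lambda> u"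
  using assms by (auto simp: semilinear_def)

lemma semilinear_zero:
  assumes "semilinear n \<Lambda>" shows "\<Lambda> (0\<^sub>v n) = 0"
proof -
  have "\<Lambda> (0 \<cdot>\<^sub>v 0\<^sub>v n) = 0" using semilinear_smult[OF assms, of "0\<^sub>v n" 0] by simp
  moreover have "0 \<cdot>\<^sub>v 0\<^sub>v n = (0\<^sub>v n :: 'a vec)" by (intro eq_vecI) auto
  ultimately show ?thesis by simp
qed

lemma semilinear_diff:
  assumes "semilinear n \<Lambda>" "u \<in> carrier_vec n" "v \<in> carrier_vec n"
  shows "\<Lambda> (u - v) = \<Lambda> u - \<Lambda> v"
proof -
  have "u - v = u + (- 1) \<cdot>\<^sub>v v" using assms by (intro eq_vecI) auto
  thus ?thesis using assms semilinear_add[OF assms(1), of u "(- 1) \<cdot>\<^sub>v v"] semilinear_smult[OF assms(1,3), of "- 1"]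
    by (simp add: hom_distribs)
qed

lemma semilinear_inj_onI:
  assumes "semilinear n \<Lambda>" "\<And>u. u \<in> carrier_vec n \<Longrightarrow> \<Lambda> u = 0 \<Longrightarrow> u = 0\<^sub>v n"
  shows "inj_on \<Lambda> (carrier_vec n)"
proof (rule inj_onI)
  fix u v assume uv: "u \<in> carrier_vec n" "v \<in> carrier_vec n" "\<Lambda> u = \<Lambda> v"
  hence "u - v = 0\<^sub>v n" using assms(2)[of "u - v"] semilinear_diff[OF assms(1)] by simp
  hence "\<forall>i<n. (u - v) $ i = 0" by simp
  thus "u = v" using uv by (intro eq_vecI) auto
qed

lemma semilinear_eval:
  assumes \<Lambda>: "semilinear n \<Lambda>" and u: "u \<in> carrier_vec n"
  shows "\<Lambda> u = (\<Sum>j<n. hom (u $ j) * \<Lambda> (unit_vec n j))"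
proof -
  have "\<Lambda> (vec n (\<lambda>i. if i < m then u $ i else 0)) = (\<Sum>j<m. hom (u $ j) * \<Lambda> (unit_vec n j))" if "m \<le> n" for m
    using that
  proof (induction m)
    case 0
    have "vec n (\<lambda>i. if i < 0 then u $ i else 0) = 0\<^sub>v n" by (intro eq_vecI) auto
    thus ?case using semilinear_zero[OF \<Lambda>] by simp
  next
    case (Suc m)
    have "vec n (\<lambda>i. if i < Suc m then u $ i else 0) =
        vec n (\<lambda>i. if i < m then u $ i else 0) + (u $ m) \<cdot>\<^sub>v unit_vec n m"
      using Suc.prems by (intro eq_vecI) (auto simp: less_Suc_eq)
    thus ?case using Suc semilinear_add[OF \<Lambda>] semilinear_smult[OF \<Lambda>] by simp
  qed
  from this[of n] have "\<Lambda> (vec n (\<lambda>i. if i < n then u $ i else 0)) = (\<Sum>j<n. hom (u $ j) * \<Lambda> (unit_vec n j))" by simp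
  moreover have "vec n (\<lambda>i. if i < n then u $ i else 0) = u" using u by (intro eq_vecI) auto
  ultimately show ?thesis by simp
qed

text \<open>Preimages under \<open>\<Psi>\<close> of the values of \<open>\<Lambda>\<close> at the unit vectors are the columns of \<open>P\<close>.\<close>
lemma semilinear_factor:
  assumes \<Lambda>: "semilinear n \<Lambda>" and \<Psi>: "semilinear n \<Psi>"
    and sub: "\<And>u. u \<in> carrier_vec n \<Longrightarrow> \<Lambda> u \<in> \<Psi> ` carrier_vec n"
  shows "\<exists>P\<in>carrier_mat n n. \<forall>u\<in>carrier_vec n. \<Psi> (P *\<^sub>v u) = \<Lambda> u"
proof -
  have "\<exists>p. p \<in> carrier_vec n \<and> \<Psi> p = \<Lambda> (unit_vec n j)" for j
    using sub[of "unit_vec n j"] by fastforce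
  then obtain p where p: "\<And>j. p j \<in> carrier_vec n" "\<And>j. \<Psi> (p j) = \<Lambda> (unit_vec n j)" by metis
  define P where "P = mat n n (\<lambda>(i, j). p j $ i)"
  have P: "P \<in> carrier_mat n n" by (simp add: P_def)
  have "\<Psi> (P *\<^sub>v u) = \<Lambda> u" if u: "u \<in> carrier_vec n" for u
  proof -
    have "\<Psi> (P *\<^sub>v u) = (\<Sum>i<n. hom ((P *\<^sub>v u) $ i) * \<Psi> (unit_vec n i))"
      using P u by (intro semilinear_eval[OF \<Psi>]) auto
    also have "\<dots> = (\<Sum>i<n. (\<Sum>j<n. hom (p j $ i) * hom (u $ j)) * \<Psi> (unit_vec n i))"
      using u by (intro sum.cong refl) (simp add: P_def scalar_prod_def lessThan_atLeast0 hom_distribs)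
    also have "\<dots> = (\<Sum>j<n. \<Sum>i<n. hom (p j $ i) * hom (u $ j) * \<Psi> (unit_vec n i))"
      unfolding sum_distrib_right by (rule sum.swap)
    also have "\<dots> = (\<Sum>j<n. hom (u $ j) * (\<Sum>i<n. hom (p j $ i) * \<Psi> (unit_vec n i)))"
      by (simp add: sum_distrib_left mult_ac)
    also have "\<dots> = (\<Sum>j<n. hom (u $ j) * \<Lambda> (unit_vec n j))"
      using semilinear_eval[OF \<Psi> p(1), symmetric] by (simp add: p(2))
    also have "\<dots> = \<Lambda> u" by (rule semilinear_eval[OF \<Lambda> u, symmetric])
    finally show ?thesis .
  qed
  thus ?thesis using P by blast
qed

end

section \<open>The characters occurring in an irreducible representation\<close>

text \<open>The ground field \<open>'f\<close> is embedded in a field \<open>'k\<close> with a primitive root of unity of order the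
  exponent of \<open>G\<close>; it is used both for an algebraic closure of a finite field and for \<open>'f = 'k = \<complex>\<close>.\<close>
locale representation_setting = finite_abelian_group G + field_hom \<iota>
  for G (structure) and \<iota> :: "'f :: field \<Rightarrow> 'k :: field" +
  fixes \<epsilon> :: 'k
  assumes \<epsilon>: "prim_root (group_exponent G) \<epsilon>"
    and order_nonzero: "of_nat (Coset.order G) \<noteq> (0 :: 'k)"
begin

abbreviation "e \<equiv> group_exponent G"

lemma exponent_nonzero: "of_nat e \<noteq> (0 :: 'k)"
proof -
  obtain c where "Coset.order G = e * c" using exponent_dvd_order by blast
  thus ?thesis using order_nonzero by auto
qed

definition eigenfunctional :: "nat \<Rightarrow> ('a \<Rightarrow> 'f mat) \<Rightarrow> ('a \<Rightarrow> 'k) \<Rightarrow> ('f vec \<Rightarrow> 'k) \<Rightarrow> bool" where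
  "eigenfunctional n \<rho> \<chi> \<Lambda> \<longleftrightarrow> semilinear n \<Lambda> \<and> (\<exists>u\<in>carrier_vec n. \<Lambda> u \<noteq> 0) \<and>
     (\<forall>g\<in>carrier G. \<forall>u\<in>carrier_vec n. \<Lambda> (\<rho> g *\<^sub>v u) = \<chi> g * \<Lambda> u)"

definition occurs :: "nat \<Rightarrow> ('a \<Rightarrow> 'f mat) \<Rightarrow> ('a \<Rightarrow> 'k) \<Rightarrow> bool" where
  "occurs n \<rho> \<chi> \<longleftrightarrow> (\<exists>\<Lambda>. eigenfunctional n \<rho> \<chi> \<Lambda>)"

text \<open>\<open>E j\<close> is the projection, up to the factor \<open>e\<close>, onto the functionals on which \<open>h\<close> acts by
  \<open>\<epsilon>\<^sup>-\<^sup>j\<close>.  These projections sum to \<open>e\<close> and preserve the eigenspaces of every other group element.\<close>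
lemma eigen_projection:
  assumes \<rho>: "representation G n \<rho>" and h: "h \<in> carrier G"
    and \<Lambda>: "semilinear n \<Lambda>"
  defines "E j u \<equiv> (\<Sum>i<e. \<epsilon> ^ (j * i) * \<Lambda> (\<rho> (h [^] i) *\<^sub>v u))"
  shows "semilinear n (E j)"
    and "u \<in> carrier_vec n \<Longrightarrow> E j (\<rho> h *\<^sub>v u) = inverse (\<epsilon> ^ j) * E j u"
    and "u \<in> carrier_vec n \<Longrightarrow> (\<Sum>j<e. E j u) = of_nat e * \<Lambda> u"
    and "g \<in> carrier G \<Longrightarrow> (\<And>u. u \<in> carrier_vec n \<Longrightarrow> \<Lambda> (\<rho> g *\<^sub>v u) = c * \<Lambda> u) \<Longrightarrow>
      u \<in> carrier_vec n \<Longrightarrow> E j (\<rho> g *\<^sub>v u) = c * E j u"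
proof -
  have hi: "h [^] (i :: nat) \<in> carrier G" for i using h by simp
  have \<epsilon>0: "\<epsilon> \<noteq> 0" using \<epsilon> exponent_pos by (auto simp: prim_root_def power_0_left)
  have \<rho>mat: "\<rho> (h [^] i) \<in> carrier_mat n n" for i :: nat using rep_carrier[OF \<rho> hi] .
  show "semilinear n (E j)"
    using rep_vec[OF \<rho> hi] unfolding semilinear_def E_def
    by (simp add: mult_add_distrib_mat_vec[OF \<rho>mat] mult_mat_vec[OF \<rho>mat] semilinear_add[OF \<Lambda>]
        semilinear_smult[OF \<Lambda>] algebra_simps sum.distrib sum_distrib_left)
  show "E j (\<rho> h *\<^sub>v u) = inverse (\<epsilon> ^ j) * E j u" if u: "u \<in> carrier_vec n"
  proof -
    define t where "t i = \<epsilon> ^ (j * i) * \<Lambda> (\<rho> (h [^] i) *\<^sub>v u)" for i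
    have "\<rho> (h [^] i) *\<^sub>v (\<rho> h *\<^sub>v u) = \<rho> (h [^] Suc i) *\<^sub>v u" for i
      using rep_mult[OF \<rho> hi h u] by simp
    hence "\<epsilon> ^ j * E j (\<rho> h *\<^sub>v u) = (\<Sum>i<e. t (Suc i))"
      by (simp add: E_def t_def sum_distrib_left power_add mult_ac)
    also have "(\<Sum>i<m. t (Suc i)) = (\<Sum>i<m. t i) + t m - t 0" for m
      by (induction m) (simp_all add: algebra_simps)
    also have "t e = t 0"
      using \<epsilon> by (simp add: t_def pow_exponent[OF h] prim_root_eq_1_iff)
    finally have "\<epsilon> ^ j * E j (\<rho> h *\<^sub>v u) = E j u" by (simp add: E_def t_def)
    thus ?thesis using \<epsilon>0 by (simp add: field_simps)
  qed
  show "(\<Sum>j<e. E j u) = of_nat e * \<Lambda> u" if u: "u \<in> carrier_vec n"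
  proof -
    have geo: "(\<Sum>j<e. \<epsilon> ^ (j * i)) = (if i = 0 then of_nat e else 0)" if "i < e" for i
    proof (cases "i = 0")
      case False
      hence "\<not> e dvd i" using that by (simp add: nat_dvd_not_less)
      hence "\<epsilon> ^ i \<noteq> 1" using \<epsilon> by (simp add: prim_root_eq_1_iff)
      moreover have "(\<epsilon> ^ i) ^ e = 1" using \<epsilon> by (simp add: prim_root_eq_1_iff flip: power_mult)
      hence "(\<epsilon> ^ i - 1) * (\<Sum>j<e. (\<epsilon> ^ i) ^ j) = 0" using power_diff_1_eq[of "\<epsilon> ^ i" e] by simp
      ultimately have "(\<Sum>j<e. (\<epsilon> ^ i) ^ j) = 0" by simp
      thus ?thesis using False by (simp add: mult.commute flip: power_mult)
    qed simp
    have "(\<Sum>j<e. E j u) = (\<Sum>i<e. \<Sum>j<e. \<epsilon> ^ (j * i) * \<Lambda> (\<rho> (h [^] i) *\<^sub>v u))"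
      unfolding E_def by (rule sum.swap)
    also have "\<dots> = (\<Sum>i<e. if i = 0 then of_nat e * \<Lambda> (\<rho> (h [^] (0::nat)) *\<^sub>v u) else 0)"
      by (intro sum.cong refl) (simp add: geo flip: sum_distrib_right)
    also have "\<dots> = of_nat e * \<Lambda> u" using exponent_pos rep_one[OF \<rho> u] by simp
    finally show ?thesis .
  qed
  show "E j (\<rho> g *\<^sub>v u) = c * E j u"
    if g: "g \<in> carrier G" and c: "\<And>u. u \<in> carrier_vec n \<Longrightarrow> \<Lambda> (\<rho> g *\<^sub>v u) = c * \<Lambda> u"
      and u: "u \<in> carrier_vec n"
  proof -
    have "\<rho> (h [^] i) *\<^sub>v (\<rho> g *\<^sub>v u) = \<rho> g *\<^sub>v (\<rho> (h [^] i) *\<^sub>v u)" for i :: nat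
      using rep_mult[OF \<rho> hi g u] rep_mult[OF \<rho> g hi u] m_comm[OF hi g] by metis
    thus ?thesis using c rep_vec[OF \<rho> hi u] by (simp add: E_def sum_distrib_left mult_ac)
  qed
qed

lemma eigenfunctional_imp_char:
  assumes \<rho>: "representation G n \<rho>" and \<Lambda>: "semilinear n \<Lambda>"
    and u: "u \<in> carrier_vec n" "\<Lambda> u \<noteq> 0"
    and c: "\<And>g v. g \<in> carrier G \<Longrightarrow> v \<in> carrier_vec n \<Longrightarrow> \<Lambda> (\<rho> g *\<^sub>v v) = c g * \<Lambda> v"
  shows "restrict c (carrier G) \<in> chars G" "occurs n \<rho> (restrict c (carrier G))"
proof -
  have mult: "c (g \<otimes> h) = c g * c h" if "g \<in> carrier G" "h \<in> carrier G" for g h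
  proof -
    have "c (g \<otimes> h) * \<Lambda> u = (c g * c h) * \<Lambda> u"
      using that u c rep_vec[OF \<rho>] rep_mult[OF \<rho> that u(1)] by (metis m_closed mult.assoc)
    thus ?thesis using u by simp
  qed
  have one: "c \<one> = 1" using c[of \<one> u] rep_one[OF \<rho>] u by simp
  have "c g \<noteq> 0" if "g \<in> carrier G" for g
    using mult[OF that inv_closed[OF that]] one that by auto
  thus "restrict c (carrier G) \<in> chars G" using mult by (auto simp: chars_def)
  show "occurs n \<rho> (restrict c (carrier G))"
    unfolding occurs_def eigenfunctional_def using \<Lambda> u c by (intro exI[of _ \<Lambda>]) auto
qed

text \<open>A common eigenfunctional is found by treating the group elements one by one: if \<open>\<Lambda>\<close> is an
  eigenfunctional for those in \<open>H\<close>, some projection of it to an eigenspace of \<open>h\<close> is nonzero and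
  is an eigenfunctional for \<open>insert h H\<close>.\<close>
lemma occurs_exists:
  assumes \<rho>: "representation G n \<rho>" and n: "n > 0"
  shows "\<exists>\<chi>\<in>chars G. occurs n \<rho> \<chi>"
proof -
  have "\<exists>\<Lambda>. semilinear n \<Lambda> \<and> (\<exists>u\<in>carrier_vec n. \<Lambda> u \<noteq> 0) \<and>
      (\<forall>h\<in>H. \<exists>c. \<forall>u\<in>carrier_vec n. \<Lambda> (\<rho> h *\<^sub>v u) = c * \<Lambda> u)" if "H \<subseteq> carrier G" for H
    using finite_subset[OF that fin] that
  proof (induction H rule: finite_induct)
    case empty
    \<comment> \<open>The base case takes the first coordinate, which is nonzero because \<open>n > 0\<close>.\<close>
    have "semilinear n (\<lambda>u :: 'f vec. \<iota> (u $ 0))" using n by (auto simp: semilinear_def hom_distribs)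
    moreover have "\<iota> (unit_vec n 0 $ 0) \<noteq> 0" using n by simp
    ultimately show ?case by (intro exI[of _ "\<lambda>u :: 'f vec. \<iota> (u $ 0)"]) (auto intro!: bexI[of _ "unit_vec n 0"])
  next
    case (insert h H)
    then obtain \<Lambda> u where \<Lambda>: "semilinear n \<Lambda>" and u: "u \<in> carrier_vec n" "\<Lambda> u \<noteq> 0"
      and H: "\<forall>h\<in>H. \<exists>c. \<forall>u\<in>carrier_vec n. \<Lambda> (\<rho> h *\<^sub>v u) = c * \<Lambda> u" by auto
    have h: "h \<in> carrier G" and HG: "H \<subseteq> carrier G" using insert.prems by auto
    define E where "E j u = (\<Sum>i<e. \<epsilon> ^ (j * i) * \<Lambda> (\<rho> (h [^] i) *\<^sub>v u))" for j u
    note P = eigen_projection[OF \<rho> h \<Lambda>, folded E_def]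
    have "\<exists>j<e. E j u \<noteq> 0"
    proof (rule ccontr)
      assume "\<not> (\<exists>j<e. E j u \<noteq> 0)"
      hence "(\<Sum>j<e. E j u) = 0" by simp
      thus False using P(3)[OF u(1)] exponent_nonzero u by simp
    qed
    then obtain j where j: "E j u \<noteq> 0" by blast
    have "\<exists>c. \<forall>u\<in>carrier_vec n. E j (\<rho> g *\<^sub>v u) = c * E j u" if g: "g \<in> insert h H" for g
    proof (cases "g = h")
      case True
      thus ?thesis using P(2) by blast
    next
      case False
      hence "g \<in> H" using g by simp
      then obtain c where "\<forall>u\<in>carrier_vec n. \<Lambda> (\<rho> g *\<^sub>v u) = c * \<Lambda> u" using H by blast
      thus ?thesis using P(4)[of g c] \<open>g \<in> H\<close> HG by blast
    qed
    thus ?case using P(1)[of j] u j by (intro exI[of _ "E j"]) auto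
  qed
  from this[OF subset_refl] obtain \<Lambda> u where \<Lambda>: "semilinear n \<Lambda>" and u: "u \<in> carrier_vec n" "\<Lambda> u \<noteq> 0"
    and "\<forall>h\<in>carrier G. \<exists>c. \<forall>u\<in>carrier_vec n. \<Lambda> (\<rho> h *\<^sub>v u) = c * \<Lambda> u" by blast
  then obtain c where "\<And>g v. g \<in> carrier G \<Longrightarrow> v \<in> carrier_vec n \<Longrightarrow> \<Lambda> (\<rho> g *\<^sub>v v) = c g * \<Lambda> v"
    by metis
  from eigenfunctional_imp_char[OF \<rho> \<Lambda> u this] show ?thesis by blast
qed

lemma irreducible_imp_representation: "irreducible_rep G n \<rho> \<Longrightarrow> representation G n \<rho>"
  and irreducible_imp_pos: "irreducible_rep G n \<rho> \<Longrightarrow> n > 0"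
  by (simp_all add: irreducible_rep_def)

lemma eigenfunctionalD:
  assumes "eigenfunctional n \<rho> \<chi> \<Lambda>"
  shows "semilinear n \<Lambda>" "\<exists>u\<in>carrier_vec n. \<Lambda> u \<noteq> 0"
    "g \<in> carrier G \<Longrightarrow> u \<in> carrier_vec n \<Longrightarrow> \<Lambda> (\<rho> g *\<^sub>v u) = \<chi> g * \<Lambda> u"
  using assms by (auto simp: eigenfunctional_def)

text \<open>The kernel is an invariant subspace.\<close>
lemma eigenfunctional_inj:
  assumes irr: "irreducible_rep G n \<rho>" and \<Lambda>: "eigenfunctional n \<rho> \<chi> \<Lambda>"
  shows "inj_on \<Lambda> (carrier_vec n)"
proof (rule semilinear_inj_onI)
  show lin: "semilinear n \<Lambda>" by (rule eigenfunctionalD(1)[OF \<Lambda>])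
  have rep: "representation G n \<rho>" by (rule irreducible_imp_representation[OF irr])
  let ?W = "{u \<in> carrier_vec n. \<Lambda> u = 0}"
  have "?W = {0\<^sub>v n} \<or> ?W = carrier_vec n"
    by (rule irreducible_repD[OF irr])
      (auto simp: semilinear_zero[OF lin] semilinear_add[OF lin] semilinear_smult[OF lin]
        eigenfunctionalD(3)[OF \<Lambda>] rep_vec[OF rep])
  moreover have "?W \<noteq> carrier_vec n" using eigenfunctionalD(2)[OF \<Lambda>] by auto
  ultimately show "u = 0\<^sub>v n" if "u \<in> carrier_vec n" "\<Lambda> u = 0" for u using that by blast
qed

lemma eigenfunctional_cmult:
  assumes "eigenfunctional n \<rho> \<chi> \<Lambda>" "c \<noteq> 0"
  shows "eigenfunctional n \<rho> \<chi> (\<lambda>u. c * \<Lambda> u)"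
  using assms by (auto simp: eigenfunctional_def semilinear_def algebra_simps)

sublocale vs: vector_space "\<lambda>a x. \<iota> a * x"
  by standard (simp_all add: algebra_simps hom_distribs)

text \<open>As the values of \<open>\<chi>\<close> form a group of roots of unity, their span is the subfield that they generate
  over the ground field.\<close>
definition char_span :: "('a \<Rightarrow> 'k) \<Rightarrow> 'k set" where
  "char_span \<chi> = vs.span (\<chi> ` carrier G)"

lemma char_span_mult:
  assumes \<chi>: "\<chi> \<in> chars G" and g: "g \<in> carrier G" and x: "x \<in> char_span \<chi>"
  shows "\<chi> g * x \<in> char_span \<chi>"
  using x unfolding char_span_def
proof (induction rule: vs.span_induct_alt)
  case base
  show ?case using vs.span_zero by simp
next
  case (step c x y)
  then obtain h where h: "h \<in> carrier G" "x = \<chi> h" by blast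
  have "\<chi> g * x \<in> \<chi> ` carrier G" using h g chars_mult[OF \<chi> g h(1), symmetric] by auto
  hence "\<iota> c * (\<chi> g * x) + \<chi> g * y \<in> vs.span (\<chi> ` carrier G)"
    using step by (intro vs.span_add vs.span_scale) (auto intro: vs.span_base)
  thus ?case by (simp add: algebra_simps)
qed

lemma char_span_one: "\<chi> \<in> chars G \<Longrightarrow> 1 \<in> char_span \<chi>"
  unfolding char_span_def using chars_one[of \<chi>] by (intro vs.span_base) (metis imageI one_closed)

lemma char_span_induct:
  assumes "\<chi> \<in> chars G" and "x \<in> char_span \<chi>"
    and "P 0" "\<And>x y. P x \<Longrightarrow> P y \<Longrightarrow> P (x + y)" "\<And>a x. P x \<Longrightarrow> P (\<iota> a * x)"
    and "\<And>g. g \<in> carrier G \<Longrightarrow> P (\<chi> g)"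
  shows "P x"
  using assms(2) unfolding char_span_def
  by (induction rule: vs.span_induct_alt) (use assms in auto)

text \<open>The multipliers \<open>x\<close> that send \<open>\<Lambda> u\<close> into the image of the invariant subspace \<open>W\<close> form a subspace
  containing the values of \<open>\<chi>\<close>.\<close>
lemma char_span_subset:
  assumes \<chi>: "\<chi> \<in> chars G" and rep: "representation G n \<rho>" and \<Lambda>: "semilinear n \<Lambda>"
    and ev: "\<And>g u. g \<in> carrier G \<Longrightarrow> u \<in> carrier_vec n \<Longrightarrow> \<Lambda> (\<rho> g *\<^sub>v u) = \<chi> g * \<Lambda> u"
    and W: "W \<subseteq> carrier_vec n" "0\<^sub>v n \<in> W" "\<And>u v. u \<in> W \<Longrightarrow> v \<in> W \<Longrightarrow> u + v \<in> W"
      "\<And>c u. u \<in> W \<Longrightarrow> c \<cdot>\<^sub>v u \<in> W" "\<And>g w. g \<in> carrier G \<Longrightarrow> w \<in> W \<Longrightarrow> \<rho> g *\<^sub>v w \<in> W"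
    and u: "u \<in> W" and x: "x \<in> char_span \<chi>"
  shows "x * \<Lambda> u \<in> \<Lambda> ` W"
proof (rule char_span_induct[OF \<chi> x])
  show "0 * \<Lambda> u \<in> \<Lambda> ` W" using W(2) semilinear_zero[OF \<Lambda>] by (metis imageI mult_zero_left)
next
  fix x y assume "x * \<Lambda> u \<in> \<Lambda> ` W" "y * \<Lambda> u \<in> \<Lambda> ` W"
  then obtain v w where vw: "v \<in> W" "w \<in> W" "x * \<Lambda> u = \<Lambda> v" "y * \<Lambda> u = \<Lambda> w" by blast
  moreover from this have "v \<in> carrier_vec n" "w \<in> carrier_vec n" using W(1) by auto
  ultimately have "(x + y) * \<Lambda> u = \<Lambda> (v + w)" by (simp add: distrib_right semilinear_add[OF \<Lambda>])
  thus "(x + y) * \<Lambda> u \<in> \<Lambda> ` W" using W(3) vw by blast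
next
  fix a x assume "x * \<Lambda> u \<in> \<Lambda> ` W"
  then obtain v where v: "v \<in> W" "x * \<Lambda> u = \<Lambda> v" by blast
  hence "\<iota> a * x * \<Lambda> u = \<Lambda> (a \<cdot>\<^sub>v v)" using W(1) semilinear_smult[OF \<Lambda>, of v a] by (auto simp: mult.assoc)
  thus "\<iota> a * x * \<Lambda> u \<in> \<Lambda> ` W" using W(4) v by blast
next
  fix g assume "g \<in> carrier G"
  thus "\<chi> g * \<Lambda> u \<in> \<Lambda> ` W" using ev[of g u] W(1,5) u by (metis imageI subsetD)
qed

text \<open>The vectors that \<open>\<Lambda>\<close> maps to the line through \<open>\<Lambda> u\<close> form an invariant subspace that contains \<open>u\<close>, so
  by irreducibility all vectors do.\<close>
lemma eigenfunctional_image: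
  assumes irr: "irreducible_rep G n \<rho>" and \<chi>: "\<chi> \<in> chars G" and \<Lambda>: "eigenfunctional n \<rho> \<chi> \<Lambda>"
    and u: "u \<in> carrier_vec n" "\<Lambda> u \<noteq> 0"
  shows "\<Lambda> ` carrier_vec n = (\<lambda>x. x * \<Lambda> u) ` char_span \<chi>"
proof
  note lin = eigenfunctionalD(1)[OF \<Lambda>]
  have rep: "representation G n \<rho>" by (rule irreducible_imp_representation[OF irr])
  show "(\<lambda>x. x * \<Lambda> u) ` char_span \<chi> \<subseteq> \<Lambda> ` carrier_vec n"
    using char_span_subset[OF \<chi> rep lin eigenfunctionalD(3)[OF \<Lambda>] subset_refl _ _ _ _ u(1)] rep_vec[OF rep]
    by auto
  let ?W = "{v \<in> carrier_vec n. \<Lambda> v \<in> (\<lambda>x. x * \<Lambda> u) ` char_span \<chi>}"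
  have "?W = {0\<^sub>v n} \<or> ?W = carrier_vec n"
  proof (rule irreducible_repD[OF irr])
    show "0\<^sub>v n \<in> ?W" using vs.span_zero by (auto simp: semilinear_zero[OF lin] char_span_def)
    show "v + w \<in> ?W" if "v \<in> ?W" "w \<in> ?W" for v w
    proof -
      from that obtain x y where "x \<in> char_span \<chi>" "y \<in> char_span \<chi>" "\<Lambda> v = x * \<Lambda> u" "\<Lambda> w = y * \<Lambda> u"
        by auto
      thus ?thesis using that vs.span_add[of x "\<chi> ` carrier G" y]
        by (auto simp: semilinear_add[OF lin] char_span_def intro!: image_eqI[of _ _ "x + y"] simp: algebra_simps)
    qed
    show "c \<cdot>\<^sub>v v \<in> ?W" if "v \<in> ?W" for c v
    proof -
      from that obtain x where "x \<in> char_span \<chi>" "\<Lambda> v = x * \<Lambda> u" by auto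
      thus ?thesis using that vs.span_scale[of x "\<chi> ` carrier G" c]
        by (auto simp: semilinear_smult[OF lin] char_span_def intro!: image_eqI[of _ _ "\<iota> c * x"])
    qed
    show "\<rho> g *\<^sub>v v \<in> ?W" if "g \<in> carrier G" "v \<in> ?W" for g v
    proof -
      from that obtain x where "x \<in> char_span \<chi>" "\<Lambda> v = x * \<Lambda> u" by auto
      thus ?thesis using that char_span_mult[OF \<chi>, of g x]
        by (auto simp: eigenfunctionalD(3)[OF \<Lambda>] rep_vec[OF rep] intro!: image_eqI[of _ _ "\<chi> g * x"])
    qed
  qed auto
  moreover have "u \<in> ?W" using u char_span_one[OF \<chi>] by (auto intro!: image_eqI[of _ _ 1])
  moreover have "u \<noteq> 0\<^sub>v n" using u semilinear_zero[OF lin] by auto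
  ultimately have "?W = carrier_vec n" by blast
  thus "\<Lambda> ` carrier_vec n \<subseteq> (\<lambda>x. x * \<Lambda> u) ` char_span \<chi>" by blast
qed

text \<open>After rescaling one of them, eigenfunctionals of the two representations for \<open>\<chi>\<close> are injective
  with the same image; going forth with one and back with the other intertwines.\<close>
lemma occurs_imp_equivalent:
  assumes \<rho>: "irreducible_rep G n \<rho>" and \<sigma>: "irreducible_rep G n \<sigma>" and \<chi>: "\<chi> \<in> chars G"
    and occ: "occurs n \<rho> \<chi>" "occurs n \<sigma> \<chi>"
  shows "equivalent_reps G n \<rho> \<sigma>"
proof -
  obtain \<Lambda> \<Psi>0 where \<Lambda>: "eigenfunctional n \<rho> \<chi> \<Lambda>" and \<Psi>0: "eigenfunctional n \<sigma> \<chi> \<Psi>0"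
    using occ unfolding occurs_def by blast
  obtain u v where u: "u \<in> carrier_vec n" "\<Lambda> u \<noteq> 0" and v: "v \<in> carrier_vec n" "\<Psi>0 v \<noteq> 0"
    using eigenfunctionalD(2)[OF \<Lambda>] eigenfunctionalD(2)[OF \<Psi>0] by blast
  \<comment> \<open>The factor makes \<open>\<Psi> v = \<Lambda> u\<close>, so both images are the line through \<open>\<Lambda> u\<close>.\<close>
  define \<Psi> where "\<Psi> w = (\<Lambda> u / \<Psi>0 v) * \<Psi>0 w" for w
  have \<Psi>: "eigenfunctional n \<sigma> \<chi> \<Psi>" unfolding \<Psi>_def
    using u v by (intro eigenfunctional_cmult[OF \<Psi>0]) simp
  have "\<Psi> v = \<Lambda> u" using v by (simp add: \<Psi>_def)
  hence im: "\<Lambda> ` carrier_vec n = \<Psi> ` carrier_vec n"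
    using eigenfunctional_image[OF \<rho> \<chi> \<Lambda> u] eigenfunctional_image[OF \<sigma> \<chi> \<Psi> v(1)] u by simp
  note lin = eigenfunctionalD(1)[OF \<Lambda>] eigenfunctionalD(1)[OF \<Psi>]
  note inj = inj_onD[OF eigenfunctional_inj[OF \<rho> \<Lambda>]] inj_onD[OF eigenfunctional_inj[OF \<sigma> \<Psi>]]
  note rep = irreducible_imp_representation[OF \<rho>] irreducible_imp_representation[OF \<sigma>]
  obtain P where P: "P \<in> carrier_mat n n" "\<And>w. w \<in> carrier_vec n \<Longrightarrow> \<Psi> (P *\<^sub>v w) = \<Lambda> w"
    using semilinear_factor[OF lin] im by blast
  obtain Q where Q: "Q \<in> carrier_mat n n" "\<And>w. w \<in> carrier_vec n \<Longrightarrow> \<Lambda> (Q *\<^sub>v w) = \<Psi> w"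
    using semilinear_factor[OF lin(2,1)] im by blast
  have PQ: "P * Q = 1\<^sub>m n"
  proof (rule mat_eqI_mult_vec)
    fix w :: "'f vec" assume w: "w \<in> carrier_vec n"
    have "\<Psi> ((P * Q) *\<^sub>v w) = \<Psi> w" using P Q w by (simp add: assoc_mult_mat_vec[of _ n n _ n])
    thus "(P * Q) *\<^sub>v w = 1\<^sub>m n *\<^sub>v w" using P Q w inj(2) by simp
  qed (use P Q in auto)
  have QP: "Q * P = 1\<^sub>m n"
  proof (rule mat_eqI_mult_vec)
    fix w :: "'f vec" assume w: "w \<in> carrier_vec n"
    have "\<Lambda> ((Q * P) *\<^sub>v w) = \<Lambda> w" using P Q w by (simp add: assoc_mult_mat_vec[of _ n n _ n])
    thus "(Q * P) *\<^sub>v w = 1\<^sub>m n *\<^sub>v w" using P Q w inj(1) by simp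
  qed (use P Q in auto)
  have "P * \<rho> g = \<sigma> g * P" if g: "g \<in> carrier G" for g
  proof (rule mat_eqI_mult_vec)
    note mats = rep_carrier[OF rep(1) g] rep_carrier[OF rep(2) g]
    show "P * \<rho> g \<in> carrier_mat n n" "\<sigma> g * P \<in> carrier_mat n n" using P mats by auto
    fix w :: "'f vec" assume w: "w \<in> carrier_vec n"
    have Pw: "P *\<^sub>v w \<in> carrier_vec n" using P w by simp
    have "\<Psi> ((P * \<rho> g) *\<^sub>v w) = \<chi> g * \<Lambda> w"
      using P w mats g by (simp add: assoc_mult_mat_vec[of _ n n _ n] eigenfunctionalD(3)[OF \<Lambda>])
    also have "\<dots> = \<Psi> ((\<sigma> g * P) *\<^sub>v w)"
      using P w mats g Pw by (simp add: assoc_mult_mat_vec[of _ n n _ n] eigenfunctionalD(3)[OF \<Psi>])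
    finally show "(P * \<rho> g) *\<^sub>v w = (\<sigma> g * P) *\<^sub>v w"
      using P w mats by (intro inj(2)) (auto simp: assoc_mult_mat_vec[of _ n n _ n])
  qed
  thus ?thesis unfolding equivalent_reps_def GL_carrier using P Q PQ QP by blast
qed

text \<open>Precompose an eigenfunctional of \<open>\<sigma>\<close> with the intertwining matrix.\<close>
lemma equivalent_imp_occurs:
  assumes rep: "representation G n \<rho>" "representation G n \<sigma>"
    and eq: "equivalent_reps G n \<rho> \<sigma>" and occ: "occurs n \<sigma> \<chi>"
  shows "occurs n \<rho> \<chi>"
proof -
  obtain P Q where P: "P \<in> carrier_mat n n" and Q: "Q \<in> carrier_mat n n" "P * Q = 1\<^sub>m n"
    and PP: "\<And>g. g \<in> carrier G \<Longrightarrow> P * \<rho> g = \<sigma> g * P"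
    using eq unfolding equivalent_reps_def GL_carrier by blast
  obtain \<Psi> where \<Psi>: "eigenfunctional n \<sigma> \<chi> \<Psi>" using occ by (auto simp: occurs_def)
  obtain v where v: "v \<in> carrier_vec n" "\<Psi> v \<noteq> 0" using eigenfunctionalD(2)[OF \<Psi>] by blast
  note lin = eigenfunctionalD(1)[OF \<Psi>]
  have Pc: "P *\<^sub>v w \<in> carrier_vec n" if "w \<in> carrier_vec n" for w using P that by simp
  have "semilinear n (\<lambda>w. \<Psi> (P *\<^sub>v w))"
    unfolding semilinear_def using Pc
    by (simp add: mult_add_distrib_mat_vec[OF P] mult_mat_vec[OF P] semilinear_add[OF lin] semilinear_smult[OF lin])
  moreover have "\<Psi> (P *\<^sub>v (Q *\<^sub>v v)) \<noteq> 0"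
    using v P Q by (simp add: assoc_mult_mat_vec[of P n n Q n, symmetric])
  hence "\<exists>u\<in>carrier_vec n. \<Psi> (P *\<^sub>v u) \<noteq> 0" using Q v by (intro bexI[of _ "Q *\<^sub>v v"]) auto
  moreover have "\<Psi> (P *\<^sub>v (\<rho> g *\<^sub>v w)) = \<chi> g * \<Psi> (P *\<^sub>v w)" if g: "g \<in> carrier G" and w: "w \<in> carrier_vec n" for g w
  proof -
    have "P *\<^sub>v (\<rho> g *\<^sub>v w) = (P * \<rho> g) *\<^sub>v w"
      using P w rep_carrier[OF rep(1) g] by (simp add: assoc_mult_mat_vec[of _ n n _ n])
    also have "\<dots> = \<sigma> g *\<^sub>v (P *\<^sub>v w)"
      using P w rep_carrier[OF rep(2) g] by (simp add: PP[OF g] assoc_mult_mat_vec[of _ n n _ n])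
    finally show ?thesis using eigenfunctionalD(3)[OF \<Psi> g Pc[OF w]] by simp
  qed
  ultimately show ?thesis unfolding occurs_def eigenfunctional_def by blast
qed

end

section \<open>Frobenius orbits over a finite field\<close>

lemma card_power_fixed_le:
  assumes "m > 1"
  shows "finite {x :: 'a :: field. x ^ m = x}" "card {x :: 'a :: field. x ^ m = x} \<le> m"
proof -
  define p where "p = (Polynomial.monom 1 m - Polynomial.monom 1 1 :: 'a poly)"
  have "poly.coeff p m = 1" using assms by (simp add: p_def)
  hence p: "p \<noteq> 0" by auto
  have roots: "{x. poly p x = 0} = {x. x ^ m = x}" by (simp add: p_def poly_monom)
  show "finite {x :: 'a :: field. x ^ m = x}" using poly_roots_finite[OF p] by (simp add: roots)
  have "card {x :: 'a :: field. x ^ m = x} \<le> Polynomial.degree p" using card_poly_roots_bound[OF p] by (simp add: roots)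
  also have "Polynomial.degree p \<le> m" unfolding p_def
    using assms degree_monom_le[of "1 :: 'a" m] degree_monom_le[of "1 :: 'a" 1] by (intro degree_diff_le) simp_all
  finally show "card {x :: 'a :: field. x ^ m = x} \<le> m" .
qed

text \<open>The Frobenius map of \<open>'k\<close> is described by its two properties that matter: additivity, and the
  ground field as its set of fixed points.\<close>
locale finite_representation_setting = representation_setting G \<iota> \<epsilon>
  for G (structure) and \<iota> :: "'f :: field \<Rightarrow> 'k :: field" and \<epsilon> +
  fixes q :: nat
  assumes finite_field: "finite (UNIV :: 'f set)" and card_field: "card (UNIV :: 'f set) = q"
    and frobenius_add: "(x + y :: 'k) ^ q = x ^ q + y ^ q"
    and frobenius_fixed: "(x :: 'k) ^ q = x \<longleftrightarrow> x \<in> range \<iota>"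
    and coprime_order: "coprime q (Coset.order G)"
begin

lemma q_gt_1: "q > 1"
proof -
  have "card {0, 1 :: 'f} \<le> card (UNIV :: 'f set)" by (rule card_mono[OF finite_field]) simp
  thus ?thesis by (simp add: card_field)
qed

lemma frobenius_power_add: "(x + y :: 'k) ^ (q ^ i) = x ^ (q ^ i) + y ^ (q ^ i)"
  by (induction i) (simp_all add: power_mult mult.commute[of q] frobenius_add)

lemma frobenius_power_sum: "(\<Sum>i\<in>A. f i :: 'k) ^ (q ^ j) = (\<Sum>i\<in>A. f i ^ (q ^ j))"
  using q_gt_1 by (induction A rule: infinite_finite_induct) (simp_all add: frobenius_power_add)

lemma frobenius_power_base: "(\<iota> a) ^ (q ^ i) = \<iota> a"
  using frobenius_fixed[of "\<iota> a"] by (induction i) (simp_all add: power_mult mult.commute[of q])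

lemma coprime_char_order: "\<chi> \<in> chars G \<Longrightarrow> coprime (char_order G \<chi>) q"
  using coprime_order dvd_trans[OF char_order_dvd_exponent exponent_dvd_order]
  by (metis coprime_commute coprime_divisors dvd_refl)

text \<open>The eigenfunctional is a bijection from the \<open>q\<^sup>n\<close> vectors onto a multiple of the span.\<close>
lemma card_char_span:
  assumes irr: "irreducible_rep G n \<rho>" and \<chi>: "\<chi> \<in> chars G" and occ: "occurs n \<rho> \<chi>"
  shows "finite (char_span \<chi>)" "card (char_span \<chi>) = q ^ n"
proof -
  obtain \<Lambda> u where \<Lambda>: "eigenfunctional n \<rho> \<chi> \<Lambda>" and u: "u \<in> carrier_vec n" "\<Lambda> u \<noteq> 0"
    using occ eigenfunctionalD(2) unfolding occurs_def by blast
  have inj: "inj_on (\<lambda>x. x * \<Lambda> u) (char_span \<chi>)" using u by (simp add: inj_on_def)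
  note im = eigenfunctional_image[OF irr \<chi> \<Lambda> u]
  have "finite (\<Lambda> ` carrier_vec n)" using card_carrier_vec_finite(1)[OF finite_field] by simp
  thus "finite (char_span \<chi>)" using im finite_image_iff[OF inj] by simp
  have "card (char_span \<chi>) = card (\<Lambda> ` carrier_vec n)" using im card_image[OF inj] by simp
  also have "\<dots> = q ^ n"
    using card_image[OF eigenfunctional_inj[OF irr \<Lambda>]] card_carrier_vec_finite(2)[OF finite_field] card_field by simp
  finally show "card (char_span \<chi>) = q ^ n" .
qed

text \<open>Let \<open>L\<close> be the span of the values of \<open>\<chi>\<close>, which has \<open>q\<^sup>n\<close> elements, and \<open>m = ord(q mod o)\<close> for the
  order \<open>o\<close> of \<open>\<chi>\<close>.  Values of \<open>\<chi>\<close> permute the \<open>q\<^sup>n - 1\<close> nonzero elements of \<open>L\<close>, so \<open>o\<close> divides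
  \<open>q\<^sup>n - 1\<close> and \<open>m\<close> divides \<open>n\<close>.  Conversely the \<open>m\<close>-th power of Frobenius fixes the values of \<open>\<chi>\<close> and
  hence \<open>L\<close>, and it has at most \<open>q\<^sup>m\<close> fixed points, so \<open>n \<le> m\<close>.\<close>
lemma degree_eq_ord:
  assumes irr: "irreducible_rep G n \<rho>" and \<chi>: "\<chi> \<in> chars G" and occ: "occurs n \<rho> \<chi>"
  shows "n = Pocklington.ord (char_order G \<chi>) q"
proof -
  let ?o = "char_order G \<chi>"
  define m where "m = Pocklington.ord ?o q"
  note L = card_char_span[OF irr \<chi> occ]
  have n: "n > 0" by (rule irreducible_imp_pos[OF irr])
  have m: "m > 0" unfolding m_def using coprime_char_order[OF \<chi>] by simp
  have "card (char_span \<chi> - {0}) = q ^ n - 1"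
    using L vs.span_zero by (simp add: char_span_def)
  moreover have "\<chi> g ^ card (char_span \<chi> - {0}) = 1" if g: "g \<in> carrier G" for g
    using L(1) char_span_mult[OF \<chi> g] chars_nonzero[OF \<chi> g]
    by (intro power_card_eq_1_of_stable) auto
  ultimately have "?o dvd q ^ n - 1" by (simp add: char_order_dvd_iff[OF \<chi>])
  hence "[q ^ n = 1] (mod ?o)" using q_gt_1 by (simp add: cong_altdef_nat)
  hence "m dvd n" unfolding m_def by (simp only: Pocklington.ord_divides)
  moreover have "n \<le> m"
  proof -
    have "[q ^ m = 1] (mod ?o)" unfolding m_def by (rule Pocklington.ord)
    hence "?o dvd q ^ m - 1" by (rule cong_to_1_nat)
    hence 1: "\<chi> g ^ (q ^ m - 1) = 1" if "g \<in> carrier G" for g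
      using that by (simp add: char_order_dvd_iff[OF \<chi>])
    have qm: "q ^ m > 1" by (rule one_less_power[OF q_gt_1 m])
    have val: "\<chi> g ^ (q ^ m) = \<chi> g" if "g \<in> carrier G" for g
    proof -
      have "\<chi> g ^ (q ^ m) = \<chi> g ^ (q ^ m - 1) * \<chi> g"
        using qm by (intro power_minus_mult[symmetric]) linarith
      thus ?thesis using 1[OF that] by simp
    qed
    have "x ^ (q ^ m) = x" if "x \<in> char_span \<chi>" for x
      using \<chi> that
    proof (rule char_span_induct[where P = "\<lambda>x. x ^ (q ^ m) = x"])
      show "0 ^ (q ^ m) = (0 :: 'k)" using q_gt_1 by simp
    qed (simp_all add: frobenius_power_add power_mult_distrib frobenius_power_base val)
    hence "char_span \<chi> \<subseteq> {x. x ^ (q ^ m) = x}" by blast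
    hence "card (char_span \<chi>) \<le> card {x :: 'k. x ^ (q ^ m) = x}"
      by (intro card_mono card_power_fixed_le(1)[OF qm])
    also have "\<dots> \<le> q ^ m" by (rule card_power_fixed_le(2)[OF qm])
    finally have "q ^ n \<le> q ^ m" by (simp add: L)
    thus ?thesis using q_gt_1 by simp
  qed
  ultimately show ?thesis using n unfolding m_def[symmetric] by (simp add: dvd_imp_le le_antisym)
qed

text \<open>\<open>G\<close> acts on the span \<open>L\<close> of the values of \<open>\<chi>\<close> by multiplication, and a basis of \<open>L\<close> turns this into
  matrices.  The action is irreducible: an invariant subspace that contains \<open>x \<noteq> 0\<close> contains \<open>L * x\<close>,
  which has as many elements as \<open>L\<close>.\<close>
lemma char_occurs_in_irreducible:
  assumes \<chi>: "\<chi> \<in> chars G"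
  shows "\<exists>n \<rho>. irreducible_rep G n \<rho> \<and> occurs n \<rho> \<chi>"
proof -
  obtain B where B: "B \<subseteq> \<chi> ` carrier G" "\<not> vs.dependent B" "\<chi> ` carrier G \<subseteq> vs.span B"
    using vs.maximal_independent_subset by blast
  have finB: "finite B" using B(1) fin finite_subset by blast
  have span: "vs.span B = char_span \<chi>" unfolding char_span_def
    using B vs.span_mono[of B "\<chi> ` carrier G"] vs.span_minimal[OF B(3) vs.subspace_span] by blast
  define n where "n = card B"
  obtain b where b: "bij_betw b {..<n} B"
    using ex_bij_betw_nat_finite[OF finB] unfolding n_def lessThan_atLeast0 by blast
  define \<beta> where "\<beta> u = (\<Sum>i<n. \<iota> (u $ i) * b i)" for u :: "'f vec"
  have lin: "semilinear n \<beta>"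
    unfolding semilinear_def \<beta>_def by (auto simp: hom_distribs algebra_simps sum.distrib sum_distrib_left)
  have reindex: "(\<Sum>i<n. \<iota> (f (b i)) * b i) = (\<Sum>x\<in>B. \<iota> (f x) * x)" for f
    using sum.reindex_bij_betw[OF b, of "\<lambda>x. \<iota> (f x) * x"] by simp
  have inj: "inj_on \<beta> (carrier_vec n)"
  proof (rule semilinear_inj_onI[OF lin])
    fix u :: "'f vec" assume u: "u \<in> carrier_vec n" "\<beta> u = 0"
    define f where "f x = u $ (the_inv_into {..<n} b x)" for x
    have fb: "f (b i) = u $ i" if "i < n" for i
      using b that by (simp add: f_def the_inv_into_f_f bij_betw_def)
    have "(\<Sum>x\<in>B. \<iota> (f x) * x) = 0" using u(2) by (simp add: \<beta>_def fb flip: reindex)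
    hence "\<forall>x\<in>B. f x = 0" using B(2) finB vs.independent_explicit_finite_subsets[of B] by blast
    hence "u $ i = 0" if "i < n" for i using fb[OF that] b that by (metis bij_betwE lessThan_iff)
    thus "u = 0\<^sub>v n" using u(1) by (intro eq_vecI) auto
  qed
  have im: "\<beta> ` carrier_vec n = char_span \<chi>"
  proof
    have "b i \<in> vs.span B" if "i < n" for i using b that by (auto intro!: vs.span_base dest: bij_betwE)
    thus "\<beta> ` carrier_vec n \<subseteq> char_span \<chi>"
      unfolding span[symmetric] \<beta>_def by (auto intro!: vs.span_sum vs.span_scale)
    show "char_span \<chi> \<subseteq> \<beta> ` carrier_vec n"
    proof
      fix x assume "x \<in> char_span \<chi>"
      then obtain f where "x = (\<Sum>v\<in>B. \<iota> (f v) * v)"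
        unfolding span[symmetric] vs.span_finite[OF finB] by auto
      hence "x = \<beta> (vec n (\<lambda>i. f (b i)))" by (simp add: \<beta>_def flip: reindex)
      thus "x \<in> \<beta> ` carrier_vec n" by auto
    qed
  qed
  have "\<exists>P. P \<in> carrier_mat n n \<and> (\<forall>u\<in>carrier_vec n. \<beta> (P *\<^sub>v u) = \<chi> g * \<beta> u)" if g: "g \<in> carrier G" for g
  proof -
    have "semilinear n (\<lambda>u. \<chi> g * \<beta> u)" using lin by (auto simp: semilinear_def algebra_simps)
    moreover have "\<chi> g * \<beta> u \<in> \<beta> ` carrier_vec n" if "u \<in> carrier_vec n" for u
      using char_span_mult[OF \<chi> g] that im by blast
    ultimately show ?thesis using semilinear_factor[OF _ lin, of "\<lambda>u. \<chi> g * \<beta> u"] by blast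
  qed
  then obtain \<rho> where \<rho>: "\<And>g. g \<in> carrier G \<Longrightarrow> \<rho> g \<in> carrier_mat n n"
    "\<And>g u. g \<in> carrier G \<Longrightarrow> u \<in> carrier_vec n \<Longrightarrow> \<beta> (\<rho> g *\<^sub>v u) = \<chi> g * \<beta> u" by metis
  have rep: "representation G n \<rho>" unfolding representation_iff
  proof (intro conjI ballI)
    show "\<rho> g \<in> carrier_mat n n" if "g \<in> carrier G" for g using \<rho>(1)[OF that] .
    show "\<rho> \<one> = 1\<^sub>m n"
    proof (rule mat_eqI_mult_vec)
      fix u :: "'f vec" assume u: "u \<in> carrier_vec n"
      thus "\<rho> \<one> *\<^sub>v u = 1\<^sub>m n *\<^sub>v u"
        using \<rho> by (intro inj_onD[OF inj]) (auto simp: chars_one[OF \<chi>] intro: mult_mat_vec_carrier)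
    qed (use \<rho> in auto)
    show "\<rho> (g \<otimes> h) = \<rho> g * \<rho> h" if g: "g \<in> carrier G" and h: "h \<in> carrier G" for g h
    proof (rule mat_eqI_mult_vec)
      fix u :: "'f vec" assume u: "u \<in> carrier_vec n"
      have hu: "\<rho> h *\<^sub>v u \<in> carrier_vec n" by (rule mult_mat_vec_carrier[OF \<rho>(1)[OF h] u])
      have "\<beta> (\<rho> (g \<otimes> h) *\<^sub>v u) = \<beta> (\<rho> g *\<^sub>v (\<rho> h *\<^sub>v u))"
        using g h u hu by (simp add: \<rho>(2) chars_mult[OF \<chi>])
      moreover have "\<rho> (g \<otimes> h) *\<^sub>v u \<in> carrier_vec n" "\<rho> g *\<^sub>v (\<rho> h *\<^sub>v u) \<in> carrier_vec n"
        by (rule mult_mat_vec_carrier[OF \<rho>(1)], use g h u hu in simp_all)+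
      ultimately have "\<rho> (g \<otimes> h) *\<^sub>v u = \<rho> g *\<^sub>v (\<rho> h *\<^sub>v u)" by (rule inj_onD[OF inj])
      thus "\<rho> (g \<otimes> h) *\<^sub>v u = (\<rho> g * \<rho> h) *\<^sub>v u"
        using assoc_mult_mat_vec[OF \<rho>(1)[OF g] \<rho>(1)[OF h] u] by simp
    qed (use \<rho>(1) g h in \<open>auto intro!: mult_carrier_mat[of _ n n]\<close>)
  qed
  have "\<exists>u\<in>carrier_vec n. \<beta> u \<noteq> 0" using char_span_one[OF \<chi>] im by (metis imageE zero_neq_one)
  hence eig: "eigenfunctional n \<rho> \<chi> \<beta>" using lin \<rho>(2) by (simp add: eigenfunctional_def)
  have n: "n > 0"
  proof (rule ccontr)
    assume "\<not> n > 0"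
    hence "\<beta> u = 0" for u by (simp add: \<beta>_def)
    thus False using eigenfunctionalD(2)[OF eig] by simp
  qed
  have "W = {0\<^sub>v n} \<or> W = carrier_vec n" if W: "invariant_subspace G n \<rho> W" for W
  proof (cases "W \<subseteq> {0\<^sub>v n}")
    case True
    moreover have "0\<^sub>v n \<in> W"
      using W by (simp add: invariant_subspace_def subspace_def submodule_def module_vec_simps)
    ultimately show ?thesis by blast
  next
    case False
    then obtain w where w: "w \<in> W" "w \<noteq> 0\<^sub>v n" by blast
    have sub: "W \<subseteq> carrier_vec n" "0\<^sub>v n \<in> W" "\<And>u v. u \<in> W \<Longrightarrow> v \<in> W \<Longrightarrow> u + v \<in> W"
      "\<And>c u. u \<in> W \<Longrightarrow> c \<cdot>\<^sub>v u \<in> W" "\<And>g w. g \<in> carrier G \<Longrightarrow> w \<in> W \<Longrightarrow> \<rho> g *\<^sub>v w \<in> W"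
      using W by (simp_all add: invariant_subspace_def subspace_def submodule_def module_vec_simps)
    have "\<beta> w \<noteq> 0" using w sub inj_onD[OF inj, of w "0\<^sub>v n"] semilinear_zero[OF lin] by auto
    hence "card ((\<lambda>x. x * \<beta> w) ` char_span \<chi>) = card (char_span \<chi>)"
      by (intro card_image) (simp add: inj_on_def)
    moreover have "(\<lambda>x. x * \<beta> w) ` char_span \<chi> \<subseteq> \<beta> ` W"
      using char_span_subset[OF \<chi> rep lin \<rho>(2) sub w(1)] by blast
    moreover have fin_vec: "finite (carrier_vec n :: 'f vec set)" by (rule card_carrier_vec_finite(1)[OF finite_field])
    hence "finite (\<beta> ` W)" using sub(1) finite_subset by blast
    ultimately have "card (char_span \<chi>) \<le> card (\<beta> ` W)" by (metis card_mono)
    moreover have "\<beta> ` W \<subseteq> char_span \<chi>" using im sub(1) by blast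
    moreover have "finite (char_span \<chi>)" using fin_vec im[symmetric] by simp
    ultimately have "\<beta> ` W = char_span \<chi>" by (intro card_seteq)
    hence "\<beta> ` W = \<beta> ` carrier_vec n" using im by simp
    hence "W = carrier_vec n" using inj sub(1) by (simp add: inj_on_image_eq_iff)
    thus ?thesis by simp
  qed
  hence "irreducible_rep G n \<rho>" using rep n by (simp add: irreducible_rep_def)
  thus ?thesis using eig by (auto simp: occurs_def)
qed

definition frobenius_twist :: "('a \<Rightarrow> 'k) \<Rightarrow> nat \<Rightarrow> 'a \<Rightarrow> 'k" where
  "frobenius_twist \<chi> i = restrict (\<lambda>g. \<chi> g ^ (q ^ i)) (carrier G)"

lemma frobenius_twist_chars: "\<chi> \<in> chars G \<Longrightarrow> frobenius_twist \<chi> i \<in> chars G"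
  by (simp add: chars_def frobenius_twist_def power_mult_distrib)

text \<open>Powers of Frobenius fix the ground field, so following \<open>\<Lambda>\<close> by one of them keeps it semilinear.\<close>
lemma frobenius_twist_occurs:
  assumes "occurs n \<rho> \<chi>"
  shows "occurs n \<rho> (frobenius_twist \<chi> i)"
proof -
  obtain \<Lambda> where \<Lambda>: "eigenfunctional n \<rho> \<chi> \<Lambda>" using assms by (auto simp: occurs_def)
  have "eigenfunctional n \<rho> (frobenius_twist \<chi> i) (\<lambda>u. \<Lambda> u ^ (q ^ i))"
    using \<Lambda> by (auto simp: eigenfunctional_def semilinear_def frobenius_twist_def frobenius_power_add
        power_mult_distrib frobenius_power_base)
  thus ?thesis by (auto simp: occurs_def)
qed

lemma char_power_eq_iff:
  assumes \<chi>: "\<chi> \<in> chars G"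
  shows "(\<forall>g\<in>carrier G. \<chi> g ^ a = \<chi> g ^ b) \<longleftrightarrow> [a = b] (mod char_order G \<chi>)"
proof -
  have *: "(\<forall>g\<in>carrier G. \<chi> g ^ a = \<chi> g ^ b) \<longleftrightarrow> [a = b] (mod char_order G \<chi>)" if "a \<le> b" for a b
  proof -
    have "\<chi> g ^ a = \<chi> g ^ b \<longleftrightarrow> \<chi> g ^ (b - a) = 1" if g: "g \<in> carrier G" for g
    proof -
      have "\<chi> g ^ b = \<chi> g ^ (b - a) * \<chi> g ^ a" using \<open>a \<le> b\<close> by (simp flip: power_add)
      thus ?thesis using chars_nonzero[OF \<chi> g] by (metis mult_cancel_right mult_1 power_not_zero)
    qed
    hence "(\<forall>g\<in>carrier G. \<chi> g ^ a = \<chi> g ^ b) \<longleftrightarrow> char_order G \<chi> dvd b - a"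
      by (simp add: char_order_dvd_iff[OF \<chi>])
    thus ?thesis using that by (metis cong_altdef_nat cong_sym_eq)
  qed
  show ?thesis
  proof (cases "a \<le> b")
    case False
    hence "(\<forall>g\<in>carrier G. \<chi> g ^ b = \<chi> g ^ a) \<longleftrightarrow> [b = a] (mod char_order G \<chi>)" by (intro *) simp
    thus ?thesis by (metis cong_sym_eq)
  qed (rule *)
qed

lemma frobenius_twist_eq_iff:
  assumes \<chi>: "\<chi> \<in> chars G"
  shows "frobenius_twist \<chi> i = frobenius_twist \<chi> j \<longleftrightarrow> [i = j] (mod Pocklington.ord (char_order G \<chi>) q)"
proof -
  have "frobenius_twist \<chi> i = frobenius_twist \<chi> j \<longleftrightarrow> (\<forall>g\<in>carrier G. \<chi> g ^ (q ^ i) = \<chi> g ^ (q ^ j))"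
    by (auto simp: frobenius_twist_def fun_eq_iff restrict_def)
  also have "\<dots> \<longleftrightarrow> [q ^ i = q ^ j] (mod char_order G \<chi>)" by (rule char_power_eq_iff[OF \<chi>])
  also have "\<dots> \<longleftrightarrow> [i = j] (mod Pocklington.ord (char_order G \<chi>) q)"
    by (rule order_divides_expdiff[OF coprime_char_order[OF \<chi>]])
  finally show ?thesis .
qed

text \<open>The vector \<open>w\<close> is the value at \<open>u\<close> of the linear combination of the matrices \<open>\<rho> g\<close> with coefficients
  \<open>c g\<close>, described only through the values of the two functionals.\<close>
lemma eigenfunctional_pair_combination:
  assumes rep: "representation G n \<rho>" and \<Lambda>: "eigenfunctional n \<rho> \<chi> \<Lambda>" and \<Psi>: "eigenfunctional n \<rho> \<psi> \<Psi>"
    and u: "u \<in> carrier_vec n" and A: "finite A" "A \<subseteq> carrier G"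
  shows "\<exists>w\<in>carrier_vec n. \<Lambda> w = (\<Sum>g\<in>A. \<iota> (c g) * \<chi> g) * \<Lambda> u \<and> \<Psi> w = (\<Sum>g\<in>A. \<iota> (c g) * \<psi> g) * \<Psi> u"
  using A
proof (induction A rule: finite_induct)
  case empty
  show ?case using semilinear_zero eigenfunctionalD(1)[OF \<Lambda>] eigenfunctionalD(1)[OF \<Psi>]
    by (intro bexI[of _ "0\<^sub>v n"]) auto
next
  case (insert g A)
  then obtain w where w: "w \<in> carrier_vec n" "\<Lambda> w = (\<Sum>g\<in>A. \<iota> (c g) * \<chi> g) * \<Lambda> u"
    "\<Psi> w = (\<Sum>g\<in>A. \<iota> (c g) * \<psi> g) * \<Psi> u" by auto
  have g: "g \<in> carrier G" using insert by simp
  note lin = eigenfunctionalD(1)[OF \<Lambda>] eigenfunctionalD(1)[OF \<Psi>]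
  have gu: "\<rho> g *\<^sub>v u \<in> carrier_vec n" by (rule rep_vec[OF rep g u])
  have "\<Lambda> (c g \<cdot>\<^sub>v (\<rho> g *\<^sub>v u) + w) = \<iota> (c g) * (\<chi> g * \<Lambda> u) + \<Lambda> w"
    "\<Psi> (c g \<cdot>\<^sub>v (\<rho> g *\<^sub>v u) + w) = \<iota> (c g) * (\<psi> g * \<Psi> u) + \<Psi> w"
    using gu w(1) g u
    by (simp_all add: semilinear_add[OF lin(1)] semilinear_smult[OF lin(1)] semilinear_add[OF lin(2)]
        semilinear_smult[OF lin(2)] eigenfunctionalD(3)[OF \<Lambda>] eigenfunctionalD(3)[OF \<Psi>])
  thus ?case using w gu insert.hyps
    by (intro bexI[of _ "c g \<cdot>\<^sub>v (\<rho> g *\<^sub>v u) + w"]) (auto simp: algebra_simps)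
qed

text \<open>The sums \<open>t g\<close> of the Frobenius conjugates of \<open>\<chi> g\<close> are fixed by Frobenius and so lie in the
  ground field.  They define an operator \<open>\<Sum>\<^sub>g t (g\<^sup>-\<^sup>1) \<rho> g\<close> over the ground field.  By
  orthogonality of characters it acts on \<open>\<Lambda>\<close> as \<open>|G|\<close>, but as \<open>0\<close> on an eigenfunctional \<open>\<Psi>\<close> whose
  character is not a conjugate of \<open>\<chi>\<close>.  As \<open>\<Psi>\<close> is injective, the operator would be \<open>0\<close>.\<close>
lemma occurs_imp_frobenius_twist:
  assumes irr: "irreducible_rep G n \<rho>" and \<chi>: "\<chi> \<in> chars G" and occ: "occurs n \<rho> \<chi>"
    and \<psi>: "\<psi> \<in> chars G" and occ': "occurs n \<rho> \<psi>"
  shows "\<exists>i<n. \<psi> = frobenius_twist \<chi> i"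
proof (rule ccontr)
  assume no: "\<not> (\<exists>i<n. \<psi> = frobenius_twist \<chi> i)"
  have n: "n = Pocklington.ord (char_order G \<chi>) q" by (rule degree_eq_ord[OF irr \<chi> occ])
  have npos: "n > 0" by (rule irreducible_imp_pos[OF irr])
  note rep = irreducible_imp_representation[OF irr]
  obtain \<Lambda> \<Psi> where \<Lambda>: "eigenfunctional n \<rho> \<chi> \<Lambda>" and \<Psi>: "eigenfunctional n \<rho> \<psi> \<Psi>"
    using occ occ' by (auto simp: occurs_def)
  obtain u where u: "u \<in> carrier_vec n" "\<Lambda> u \<noteq> 0" using eigenfunctionalD(2)[OF \<Lambda>] by blast
  define t where "t g = (\<Sum>i<n. \<chi> g ^ (q ^ i))" for g
  have twist_n: "\<chi> g ^ (q ^ n) = \<chi> g" if g: "g \<in> carrier G" for g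
  proof -
    have "frobenius_twist \<chi> n = frobenius_twist \<chi> 0"
      using n by (simp add: frobenius_twist_eq_iff[OF \<chi>] cong_def)
    from fun_cong[OF this, of g] show ?thesis using g by (simp add: frobenius_twist_def)
  qed
  have t_range: "t g \<in> range \<iota>" if g: "g \<in> carrier G" for g
  proof -
    have "t g ^ q = (\<Sum>i<n. \<chi> g ^ (q ^ Suc i))"
      using frobenius_power_sum[of "\<lambda>i. \<chi> g ^ (q ^ i)" "{..<n}" 1]
      by (simp add: t_def power_mult[symmetric] mult.commute)
    also have "(\<Sum>i<m. \<chi> g ^ (q ^ Suc i)) = (\<Sum>i<m. \<chi> g ^ (q ^ i)) + \<chi> g ^ (q ^ m) - \<chi> g" for m
      by (induction m) (simp_all add: algebra_simps)
    finally have "t g ^ q = t g" by (simp add: t_def twist_n[OF g])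
    thus ?thesis by (simp add: frobenius_fixed)
  qed
  define c where "c g = inv_into UNIV \<iota> (t (inv g))" for g
  have c: "\<iota> (c g) = t (inv g)" if "g \<in> carrier G" for g
    unfolding c_def by (rule f_inv_into_f) (rule t_range[OF inv_closed[OF that]])
  have orth: "(\<Sum>g\<in>carrier G. inverse (\<chi> g) ^ (q ^ i) * \<phi> g) = (if \<phi> = frobenius_twist \<chi> i then of_nat (Coset.order G) else 0)"
    if \<phi>: "\<phi> \<in> chars G" for i \<phi>
  proof (cases "\<phi> = frobenius_twist \<chi> i")
    case True
    have "(\<Sum>g\<in>carrier G. inverse (\<chi> g) ^ (q ^ i) * \<phi> g) = (\<Sum>g\<in>carrier G. 1)"
      using chars_nonzero[OF \<chi>] by (intro sum.cong refl) (simp add: True frobenius_twist_def power_inverse)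
    thus ?thesis using True by (simp add: Coset.order_def)
  next
    case False
    then obtain h where h: "h \<in> carrier G" "\<phi> h \<noteq> frobenius_twist \<chi> i h"
      using extensionalityI[OF chars_extensional[OF \<phi>] chars_extensional[OF frobenius_twist_chars[OF \<chi>]]] by blast
    have "(\<Sum>g\<in>carrier G. inverse (\<chi> g) ^ (q ^ i) * \<phi> g) = 0"
    proof (rule sum_char_eq_0)
      show "inverse (\<chi> (g \<otimes> h)) ^ (q ^ i) * \<phi> (g \<otimes> h) =
          (inverse (\<chi> g) ^ (q ^ i) * \<phi> g) * (inverse (\<chi> h) ^ (q ^ i) * \<phi> h)"
        if "g \<in> carrier G" "h \<in> carrier G" for g h
        using that by (simp add: chars_mult[OF \<chi>] chars_mult[OF \<phi>] power_mult_distrib mult_ac)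
      show "inverse (\<chi> h) ^ (q ^ i) * \<phi> h \<noteq> 1"
        using h chars_nonzero[OF \<chi> h(1)] by (auto simp: frobenius_twist_def power_inverse field_simps)
    qed (rule h)
    thus ?thesis using False by simp
  qed
  have sum: "(\<Sum>g\<in>carrier G. \<iota> (c g) * \<phi> g) = (\<Sum>i<n. if \<phi> = frobenius_twist \<chi> i then of_nat (Coset.order G) else 0)"
    if \<phi>: "\<phi> \<in> chars G" for \<phi>
  proof -
    have "(\<Sum>g\<in>carrier G. \<iota> (c g) * \<phi> g) = (\<Sum>g\<in>carrier G. \<Sum>i<n. inverse (\<chi> g) ^ (q ^ i) * \<phi> g)"
      by (intro sum.cong refl) (simp add: c t_def chars_inv[OF \<chi>] sum_distrib_right)
    also have "\<dots> = (\<Sum>i<n. \<Sum>g\<in>carrier G. inverse (\<chi> g) ^ (q ^ i) * \<phi> g)" by (rule sum.swap)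
    finally show ?thesis by (simp add: orth[OF \<phi>])
  qed
  have 0: "frobenius_twist \<chi> 0 = \<chi>"
    using chars_extensional[OF \<chi>] by (simp add: frobenius_twist_def extensional_restrict)
  have "\<chi> = frobenius_twist \<chi> i \<longleftrightarrow> i = 0" if "i < n" for i
    using that frobenius_twist_eq_iff[OF \<chi>, of 0 i] npos unfolding 0 n[symmetric] by (simp add: cong_def)
  hence "(\<Sum>i<n. if \<chi> = frobenius_twist \<chi> i then of_nat (Coset.order G) else 0) = (\<Sum>i<n. if i = 0 then of_nat (Coset.order G) else (0 :: 'k))"
    by (intro sum.cong) auto
  hence s\<chi>: "(\<Sum>g\<in>carrier G. \<iota> (c g) * \<chi> g) = of_nat (Coset.order G)"
    using npos by (simp add: sum[OF \<chi>])
  have s\<psi>: "(\<Sum>g\<in>carrier G. \<iota> (c g) * \<psi> g) = 0"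
    using no by (simp add: sum[OF \<psi>])
  obtain w where w: "w \<in> carrier_vec n" "\<Lambda> w = of_nat (Coset.order G) * \<Lambda> u" "\<Psi> w = 0"
    using eigenfunctional_pair_combination[OF rep \<Lambda> \<Psi> u(1) fin subset_refl, of c] s\<chi> s\<psi> by auto
  have "w = 0\<^sub>v n"
    using w inj_onD[OF eigenfunctional_inj[OF irr \<Psi>], of w "0\<^sub>v n"] semilinear_zero[OF eigenfunctionalD(1)[OF \<Psi>]] by simp
  hence "\<Lambda> w = 0" using semilinear_zero[OF eigenfunctionalD(1)[OF \<Lambda>]] by simp
  thus False using w(2) u(2) order_nonzero by simp
qed

lemma occurring_chars:
  assumes irr: "irreducible_rep G n \<rho>"
  shows "finite {\<chi> \<in> chars G. occurs n \<rho> \<chi>}" "card {\<chi> \<in> chars G. occurs n \<rho> \<chi>} = n"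
proof -
  obtain \<chi> where \<chi>: "\<chi> \<in> chars G" and occ: "occurs n \<rho> \<chi>"
    using occurs_exists[OF irreducible_imp_representation[OF irr] irreducible_imp_pos[OF irr]] by blast
  have eq: "{\<chi> \<in> chars G. occurs n \<rho> \<chi>} = frobenius_twist \<chi> ` {..<n}"
    using occurs_imp_frobenius_twist[OF irr \<chi> occ] frobenius_twist_chars[OF \<chi>] frobenius_twist_occurs[OF occ] by auto
  have "inj_on (frobenius_twist \<chi>) {..<n}"
    using degree_eq_ord[OF irr \<chi> occ, symmetric]
    by (auto simp: inj_on_def frobenius_twist_eq_iff[OF \<chi>] cong_def)
  thus "card {\<chi> \<in> chars G. occurs n \<rho> \<chi>} = n" by (simp add: eq card_image)
  show "finite {\<chi> \<in> chars G. occurs n \<rho> \<chi>}" by (simp add: eq)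
qed

end

section \<open>Counting\<close>

context finite_representation_setting
begin

text \<open>Sending a class to the set of characters occurring in its members is injective; the sets are
  pairwise disjoint, have \<open>n\<close> elements each, and cover the characters in question.\<close>
lemma irrep_classes_count:
  assumes n: "n > 0"
  shows "finite (irrep_classes TYPE('f) G n)"
    and "n * card (irrep_classes TYPE('f) G n) =
      card {\<chi> :: 'a \<Rightarrow> 'k. \<chi> \<in> chars G \<and> Pocklington.ord (char_order G \<chi>) q = n}"
proof -
  define A where "A = {\<rho> :: 'a \<Rightarrow> 'f mat. irreducible_rep G n \<rho>}"
  define S where "S \<rho> = {\<chi> \<in> chars G. occurs n \<rho> \<chi>}" for \<rho>
  have S: "finite (S \<rho>)" "card (S \<rho>) = n" if "\<rho> \<in> A" for \<rho>
    using occurring_chars[of n \<rho>] that by (auto simp: S_def A_def)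
  have meet: "S \<rho> = S \<sigma>" if A: "\<rho> \<in> A" "\<sigma> \<in> A" and eq: "equivalent_reps G n \<rho> \<sigma>" for \<rho> \<sigma>
  proof -
    have "S \<sigma> \<subseteq> S \<rho>"
      using equivalent_imp_occurs[OF _ _ eq] A irreducible_imp_representation by (auto simp: S_def A_def)
    thus ?thesis using S[OF A(1)] S[OF A(2)] card_subset_eq[of "S \<rho>" "S \<sigma>"] by simp
  qed
  have equiv: "equivalent_reps G n \<rho> \<sigma>" if A: "\<rho> \<in> A" "\<sigma> \<in> A" and "\<chi> \<in> S \<rho>" "\<chi> \<in> S \<sigma>" for \<rho> \<sigma> \<chi>
    using that occurs_imp_equivalent by (auto simp: S_def A_def)
  have nonempty: "S \<rho> \<noteq> {}" if "\<rho> \<in> A" for \<rho> using S[OF that] n by auto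
  define R where "R = {(\<rho>, \<sigma>). \<rho> \<in> A \<and> \<sigma> \<in> A \<and> equivalent_reps G n \<rho> \<sigma>}"
  have R: "R = {(\<rho>, \<sigma>). \<rho> \<in> A \<and> \<sigma> \<in> A \<and> S \<rho> = S \<sigma>}"
  proof -
    have "equivalent_reps G n \<rho> \<sigma> \<longleftrightarrow> S \<rho> = S \<sigma>" if A: "\<rho> \<in> A" "\<sigma> \<in> A" for \<rho> \<sigma>
    proof
      assume "S \<rho> = S \<sigma>"
      moreover obtain \<chi> where "\<chi> \<in> S \<rho>" using nonempty[OF A(1)] by blast
      ultimately show "equivalent_reps G n \<rho> \<sigma>" using equiv[OF A] by simp
    qed (rule meet[OF A])
    thus ?thesis unfolding R_def by blast
  qed
  have cls: "irrep_classes TYPE('f) G n = A // R" by (simp add: irrep_classes_def A_def R_def)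
  have "bij_betw (\<lambda>T. {\<sigma> \<in> A. S \<sigma> = T}) (S ` A) (A // R)"
  proof (rule bij_betw_imageI)
    show "inj_on (\<lambda>T. {\<sigma> \<in> A. S \<sigma> = T}) (S ` A)" by (rule inj_onI) blast
    have "R `` {\<rho>} = {\<sigma> \<in> A. S \<sigma> = S \<rho>}" if "\<rho> \<in> A" for \<rho> using that by (auto simp: R)
    thus "(\<lambda>T. {\<sigma> \<in> A. S \<sigma> = T}) ` S ` A = A // R" by (auto simp: quotient_def)
  qed
  note bij = this
  have sub: "S ` A \<subseteq> Pow (chars G)" by (auto simp: S_def)
  have fin: "finite (S ` A)" by (rule finite_subset[OF sub]) (simp add: finite_chars)
  thus "finite (irrep_classes TYPE('f) G n)" unfolding cls using bij bij_betw_finite by blast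
  have un: "\<Union> (S ` A) = {\<chi> :: 'a \<Rightarrow> 'k. \<chi> \<in> chars G \<and> Pocklington.ord (char_order G \<chi>) q = n}"
  proof safe
    fix \<chi> :: "'a \<Rightarrow> 'k" assume \<chi>: "\<chi> \<in> chars G" "n = Pocklington.ord (char_order G \<chi>) q"
    then obtain m \<rho> where "irreducible_rep G m \<rho>" "occurs m \<rho> \<chi>"
      using char_occurs_in_irreducible by blast
    thus "\<chi> \<in> \<Union> (S ` A)" using degree_eq_ord[of m \<rho> \<chi>] \<chi> by (auto simp: S_def A_def)
  qed (use degree_eq_ord in \<open>auto simp: S_def A_def\<close>)
  have "n * card (S ` A) = card (\<Union> (S ` A))"
  proof (rule card_partition[OF fin])
    show "finite (\<Union> (S ` A))" unfolding un by (rule finite_subset[OF _ finite_chars]) auto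
    show "c1 \<inter> c2 = {}" if c12: "c1 \<in> S ` A" "c2 \<in> S ` A" "c1 \<noteq> c2" for c1 c2
    proof (rule ccontr)
      obtain \<rho> \<sigma> where A: "\<rho> \<in> A" "\<sigma> \<in> A" and c: "c1 = S \<rho>" "c2 = S \<sigma>" using c12 by blast
      assume "c1 \<inter> c2 \<noteq> {}"
      then obtain \<chi> where "\<chi> \<in> S \<rho>" "\<chi> \<in> S \<sigma>" using c by blast
      hence "S \<rho> = S \<sigma>" using meet[OF A equiv[OF A]] by simp
      thus False using c12 c by simp
    qed
  qed (use S in auto)
  thus "n * card (irrep_classes TYPE('f) G n) =
      card {\<chi> :: 'a \<Rightarrow> 'k. \<chi> \<in> chars G \<and> Pocklington.ord (char_order G \<chi>) q = n}"
    using bij_betw_same_card[OF bij] by (simp add: un cls)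
qed

end

lemma ord_double:
  assumes "odd a" "odd (q :: nat)" 
  shows "Pocklington.ord (2 * a) q = Pocklington.ord a q"
proof -
  have "[q ^ k = 1] (mod 2 * a) \<longleftrightarrow> [q ^ k = 1] (mod a)" for k
  proof
    assume "[q ^ k = 1] (mod 2 * a)"
    thus "[q ^ k = 1] (mod a)" by (rule cong_dvd_modulus_nat) simp
  next
    assume "[q ^ k = 1] (mod a)"
    moreover have "odd (q ^ k)" using assms by simp
    hence "[q ^ k = 1] (mod 2)" unfolding cong_def by presburger
    ultimately show "[q ^ k = 1] (mod 2 * a)" using assms by (intro coprime_cong_mult_nat) auto
  qed
  hence "Pocklington.ord (2 * a) q dvd k \<longleftrightarrow> Pocklington.ord a q dvd k" for k
    by (simp only: Pocklington.ord_divides[symmetric])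
  thus ?thesis by (metis dvd_antisym dvd_refl)
qed

context finite_abelian_group
begin

lemma one_dimensional_irreducible:
  assumes \<chi>: "\<chi> \<in> chars G"
  shows "irreducible_rep G 1 (\<lambda>g. mat 1 1 (\<lambda>_. \<chi> g :: 'f :: field))"
  unfolding irreducible_rep_def
proof (intro conjI allI impI)
  show "representation G 1 (\<lambda>g. mat 1 1 (\<lambda>_. \<chi> g))"
    unfolding representation_iff
    by (auto intro!: eq_matI simp: chars_one[OF \<chi>] chars_mult[OF \<chi>] scalar_prod_def)
next
  fix W assume W: "invariant_subspace G 1 (\<lambda>g. mat 1 1 (\<lambda>_. \<chi> g)) W"
  have sub: "W \<subseteq> carrier_vec 1" "0\<^sub>v 1 \<in> W" "\<And>c u. u \<in> W \<Longrightarrow> c \<cdot>\<^sub>v u \<in> W"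
    using W by (simp_all add: invariant_subspace_def subspace_def submodule_def module_vec_simps)
  show "W = {0\<^sub>v 1} \<or> W = carrier_vec 1"
  proof (cases "W \<subseteq> {0\<^sub>v 1}")
    case False
    then obtain w where w: "w \<in> W" "w \<noteq> 0\<^sub>v 1" by blast
    have wc: "w \<in> carrier_vec 1" using w sub by blast
    have w0: "w $ 0 \<noteq> 0"
    proof
      assume "w $ 0 = 0"
      hence "w = 0\<^sub>v 1" using wc by (intro eq_vecI) auto
      thus False using w by simp
    qed
    have "v \<in> W" if v: "v \<in> carrier_vec 1" for v
    proof -
      have "v = (v $ 0 / w $ 0) \<cdot>\<^sub>v w" using v wc w0 by (intro eq_vecI) auto
      thus ?thesis using sub(3)[OF w(1)] by metis
    qed
    thus ?thesis using sub(1) by blast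
  qed (use sub in blast)
qed simp

lemma complex_setting:
  "representation_setting G (id :: complex \<Rightarrow> complex) (zeta (group_exponent G))"
proof unfold_locales
  show "prim_root (group_exponent G) (zeta (group_exponent G))" by (rule prim_root_zeta[OF exponent_pos])
  show "of_nat (Coset.order G) \<noteq> (0 :: complex)" using exponent_exists(1) by simp
qed auto

text \<open>The injective eigenfunctional embeds \<open>\<complex>\<^sup>n\<close> in \<open>\<complex>\<close>, so the degree is 1 and the trace is the character
  itself.\<close>
lemma complex_irreducible:
  assumes irr: "irreducible_rep G n (\<rho> :: 'a \<Rightarrow> complex mat)"
  shows "restrict (\<lambda>g. mat_trace (\<rho> g)) (carrier G) \<in> chars G"
proof -
  interpret representation_setting G "id :: complex \<Rightarrow> complex" "zeta (group_exponent G)" by (rule complex_setting)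
  have rep: "representation G n \<rho>" and n0: "n > 0" using irr by (simp_all add: irreducible_rep_def)
  obtain \<chi> \<Lambda> where \<chi>: "\<chi> \<in> chars G" and \<Lambda>: "eigenfunctional n \<rho> \<chi> \<Lambda>"
    using occurs_exists[OF rep n0] by (auto simp: occurs_def)
  note lin = eigenfunctionalD(1)[OF \<Lambda>]
  note inj = inj_onD[OF eigenfunctional_inj[OF irr \<Lambda>]]
  have zero: "u = 0\<^sub>v n" if "u \<in> carrier_vec n" "\<Lambda> u = 0" for u
    using inj[of u "0\<^sub>v n"] that semilinear_zero[OF lin] by simp
  have nz: "\<Lambda> (unit_vec n i) \<noteq> 0" if "i < n" for i
    using zero[of "unit_vec n i"] unit_vec_nonzero[OF that] by auto
  have n: "n = 1"
  proof (rule ccontr)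
    assume "n \<noteq> 1"
    hence n2: "1 < n" using n0 by simp
    \<comment> \<open>An element of the kernel, which would force \<open>\<Lambda> (unit_vec n 1) = 0\<close>.\<close>
    let ?u = "\<Lambda> (unit_vec n 1) \<cdot>\<^sub>v unit_vec n 0 + (- \<Lambda> (unit_vec n 0)) \<cdot>\<^sub>v unit_vec n 1"
    have "\<Lambda> ?u = 0" by (simp add: semilinear_add[OF lin] semilinear_smult[OF lin])
    hence "?u = 0\<^sub>v n" by (intro zero) simp_all
    hence "?u $ 0 = 0" using n0 by simp
    thus False using nz[OF n2] n2 by simp
  qed
  have "mat_trace (\<rho> g) = \<chi> g" if g: "g \<in> carrier G" for g
  proof -
    have c: "\<rho> g \<in> carrier_mat 1 1" using rep_carrier[OF rep g] n by simp
    have e: "\<rho> g *\<^sub>v unit_vec 1 0 = (\<rho> g $$ (0, 0)) \<cdot>\<^sub>v unit_vec 1 0"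
      using c mult_mat_unit_vec[OF c, of 0 0] by (intro eq_vecI) auto
    have "\<chi> g * \<Lambda> (unit_vec 1 0) = \<Lambda> (\<rho> g *\<^sub>v unit_vec 1 0)"
      using eigenfunctionalD(3)[OF \<Lambda> g, of "unit_vec 1 0"] n by simp
    also have "\<dots> = \<rho> g $$ (0, 0) * \<Lambda> (unit_vec 1 0)"
      unfolding e using semilinear_smult[OF lin, of "unit_vec 1 0"] n by simp
    finally have "\<chi> g = \<rho> g $$ (0, 0)" using nz[of 0] n by simp
    thus ?thesis using c by (simp add: mat_trace_def)
  qed
  hence "restrict (\<lambda>g. mat_trace (\<rho> g)) (carrier G) = \<chi>"
    using chars_extensional[OF \<chi>] by (intro extensionalityI[of _ "carrier G"]) auto
  thus ?thesis using \<chi> by simp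
qed

lemma Irr_eq_chars: "Irr G = chars G"
proof
  show "Irr G \<subseteq> chars G" using complex_irreducible by (auto simp: Irr_def)
  show "chars G \<subseteq> Irr G"
  proof
    fix \<chi> :: "'a \<Rightarrow> complex" assume \<chi>: "\<chi> \<in> chars G"
    have "\<chi> = restrict (\<lambda>g. mat_trace (mat 1 1 (\<lambda>_. \<chi> g))) (carrier G)"
      using chars_extensional[OF \<chi>] by (intro extensionalityI[of _ "carrier G"]) (auto simp: mat_trace_def)
    thus "\<chi> \<in> Irr G" unfolding Irr_def mem_Collect_eq
      by (intro exI conjI) (assumption, rule one_dimensional_irreducible[OF \<chi>])
  qed
qed

lemma I_chars_eq:
  assumes "d > 0"
  shows "I_chars d G = {\<chi> \<in> chars G. char_order G \<chi> = d \<or> (odd (char_order G \<chi>) \<and> d = 2 * char_order G \<chi>) \<or>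
    (odd d \<and> char_order G \<chi> = 2 * d)}"
  unfolding I_chars_def Irr_eq_chars zeta_def[symmetric]
  by (intro Collect_cong conj_cong refl)
    (simp only: character_field_eq rat_adjoin_zeta_eq_iff[OF char_order_pos assms])

text \<open>The set \<open>I\<^sub>d\<close> with \<open>d \<in> D\<^sub>n\<close> is the fibre over \<open>d\<close> of the map \<open>f\<close> that assigns to \<open>\<chi>\<close> its order,
  doubled if that is odd while \<open>e\<close> is even.\<close>
lemma sum_I_chars:
  fixes q :: nat
  assumes q: "coprime q (Coset.order G)"
  defines "e \<equiv> group_exponent G"
  shows "(\<Sum>d | d > 0 \<and> d dvd e \<and> Pocklington.ord d q = n \<and> (even e \<longrightarrow> even d). card (I_chars d G)) =
    card {\<chi> :: 'a \<Rightarrow> complex. \<chi> \<in> chars G \<and> Pocklington.ord (char_order G \<chi>) q = n}"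
proof -
  let ?o = "char_order G"
  define D where "D = {d. d > 0 \<and> d dvd e \<and> Pocklington.ord d q = n \<and> (even e \<longrightarrow> even d)}"
  have e: "e > 0" unfolding e_def by (rule exponent_pos)
  have finD: "finite D" by (rule finite_subset[of _ "{..e}"]) (auto simp: D_def e intro: dvd_imp_le)
  have o: "?o \<chi> dvd e" "?o \<chi> > 0" if "\<chi> \<in> chars G" for \<chi> :: "'a \<Rightarrow> complex"
    using char_order_dvd_exponent[OF that] char_order_pos[OF that] by (simp_all add: e_def)
  have odd_q: "odd q" if "even e"
    using that q exponent_dvd_order unfolding e_def
    by (metis coprime_common_divisor dvd_trans odd_one)
  define f where "f \<chi> = (if even e \<and> odd (?o \<chi>) then 2 * ?o \<chi> else ?o \<chi>)" for \<chi> :: "'a \<Rightarrow> complex"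
  have I: "I_chars d G = {\<chi> \<in> chars G. f \<chi> = d}" if d: "d \<in> D" for d
  proof -
    have "(?o \<chi> = d \<or> (odd (?o \<chi>) \<and> d = 2 * ?o \<chi>) \<or> (odd d \<and> ?o \<chi> = 2 * d)) \<longleftrightarrow> f \<chi> = d"
      if "\<chi> \<in> chars G" for \<chi>
    proof (cases "even e")
      case True
      thus ?thesis using d by (auto simp: f_def D_def)
    next
      case False
      hence "odd (?o \<chi>)" "odd d" using o[OF that] d by (auto simp: D_def dest: dvd_trans)
      thus ?thesis using False by (auto simp: f_def)
    qed
    moreover have "d > 0" using d by (simp add: D_def)
    ultimately show ?thesis by (auto simp: I_chars_eq)
  qed
  have fD: "f \<chi> \<in> D \<longleftrightarrow> Pocklington.ord (?o \<chi>) q = n" if \<chi>: "\<chi> \<in> chars G" for \<chi>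
  proof (cases "even e \<and> odd (?o \<chi>)")
    case True
    hence "2 * ?o \<chi> dvd e" using o[OF \<chi>] by (intro divides_mult) (auto simp: coprime_commute)
    thus ?thesis using True o[OF \<chi>] odd_q by (auto simp: f_def D_def ord_double)
  next
    case False
    thus ?thesis using o[OF \<chi>] by (auto simp: f_def D_def)
  qed
  have "(\<Sum>d\<in>D. card (I_chars d G)) = (\<Sum>d\<in>D. card {\<chi> \<in> chars G. f \<chi> = d})"
    by (intro sum.cong refl) (simp add: I)
  also have "\<dots> = card (\<Union>d\<in>D. {\<chi> \<in> chars G. f \<chi> = d})"
    using finD by (subst card_UN_disjoint) (auto intro: finite_subset[OF _ finite_chars])
  also have "(\<Union>d\<in>D. {\<chi> \<in> chars G. f \<chi> = d}) = {\<chi> \<in> chars G. Pocklington.ord (?o \<chi>) q = n}"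
    using fD by auto
  finally show ?thesis by (simp add: D_def)
qed

end

lemma finite_field_power_card:
  fixes a :: "'f :: field"
  assumes "finite (UNIV :: 'f set)"
  shows "a ^ card (UNIV :: 'f set) = a"
proof (cases "a = 0")
  case True
  thus ?thesis using assms by (simp add: card_gt_0_iff)
next
  case False
  have one: "a ^ card (UNIV - {0 :: 'f}) = 1"
    using assms False by (intro power_card_eq_1_of_stable) auto
  have "card (UNIV :: 'f set) = Suc (card (UNIV - {0 :: 'f}))"
    using card_Suc_Diff1[OF assms, of 0] by simp
  hence "a ^ card (UNIV :: 'f set) = a * a ^ card (UNIV - {0 :: 'f})" by (simp only: power_Suc)
  thus ?thesis by (simp only: one mult_1_right)
qed

text \<open>The characteristic \<open>p\<close> divides \<open>q\<close>, so \<open>q\<close> is a power of \<open>p\<close> and does not share it with \<open>|G|\<close>.  The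
  fixed points of Frobenius are the \<open>q\<close> elements of the ground field because \<open>X\<^sup>q - X\<close> has no more roots.\<close>
lemma finite_field_setting:
  assumes G: "finite_abelian_group G" and q: "primepow (q :: nat)" "coprime q (Coset.order G)"
    and card: "card (UNIV :: 'f :: field set) = q"
  shows "\<exists>\<epsilon>. finite_representation_setting G (to_ac :: 'f \<Rightarrow> 'f alg_closure) \<epsilon> q"
proof -
  interpret finite_abelian_group G by (rule G)
  have fin: "finite (UNIV :: 'f set)" using card primepow_gt_0_nat[OF q(1)] by (intro card_ge_0_finite) simp
  define p where "p = CHAR('f)"
  have p: "Factorial_Ring.prime p" unfolding p_def using prime_CHAR_semidom finite_imp_CHAR_pos[OF fin] by blast
  have pq: "p dvd q" unfolding p_def using CHAR_dvd_CARD[where 'a = 'f] card by simp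
  obtain p' k where p': "Factorial_Ring.prime p'" "q = p' ^ k" using q(1) by (auto simp: primepow_def)
  have "p = p'" using pq p p' by (metis prime_dvd_power primes_dvd_imp_eq)
  hence qk: "q = p ^ k" using p' by simp
  have char: "CHAR('f alg_closure) = p" by (simp add: p_def)
  have order: "of_nat (Coset.order G) \<noteq> (0 :: 'f alg_closure)"
  proof
    assume "of_nat (Coset.order G) = (0 :: 'f alg_closure)"
    hence "p dvd Coset.order G" by (simp only: of_nat_eq_0_iff_char_dvd char)
    thus False using pq q(2) p by (metis coprime_common_divisor not_prime_unit)
  qed
  moreover have "of_nat (Coset.order G) = (of_nat (group_exponent G) * of_nat (Coset.order G div group_exponent G) :: 'f alg_closure)"
    using exponent_dvd_order by (simp flip: of_nat_mult)
  ultimately have "of_nat (group_exponent G) \<noteq> (0 :: 'f alg_closure)" by auto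
  then obtain \<epsilon> :: "'f alg_closure" where \<epsilon>: "prim_root (group_exponent G) \<epsilon>"
    using prim_root_exists[OF exponent_pos] by blast
  have fixed: "{x :: 'f alg_closure. x ^ q = x} = range to_ac"
  proof (rule card_seteq[symmetric])
    have q1: "q > 1" using primepow_gt_Suc_0[OF q(1)] by simp
    show "finite {x :: 'f alg_closure. x ^ q = x}" by (rule card_power_fixed_le(1)[OF q1])
    show "range to_ac \<subseteq> {x :: 'f alg_closure. x ^ q = x}"
      using finite_field_power_card[OF fin] card by (auto simp flip: to_ac_power)
    show "card {x :: 'f alg_closure. x ^ q = x} \<le> card (range (to_ac :: 'f \<Rightarrow> 'f alg_closure))"
      using card_power_fixed_le(2)[OF q1, where 'a = "'f alg_closure"] card by (simp add: card_image[OF inj_to_ac])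
  qed
  have "finite_representation_setting G (to_ac :: 'f \<Rightarrow> 'f alg_closure) \<epsilon> q"
  proof unfold_locales
    show "(x + y) ^ q = x ^ q + y ^ q" for x y :: "'f alg_closure"
      by (rule freshmans_dream'[OF _ qk[folded char]]) (simp add: p char del: CHAR_alg_closure)
  qed (use \<epsilon> order fin card fixed q(2) in auto)
  thus ?thesis by blast
qed

theorem theorem2p1:
  fixes G :: "('g, 'b) monoid_scheme" and e q :: nat
  assumes "comm_group G" and "finite (carrier G)"
    and "e = group_exponent G"
    and "primepow q" and "coprime q (Coset.order G)"
    and "card (UNIV :: 'f :: field set) = q"
  shows "(\<forall>n (\<rho> :: 'g \<Rightarrow> 'f mat). irreducible_rep G n \<rho> \<longrightarrow>
            (\<exists>d. d > 0 \<and> d dvd e \<and> n = ord d q)) \<and>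
         (\<forall>n > 0. finite (irrep_classes TYPE('f) G n) \<and>
            real (card (irrep_classes TYPE('f) G n)) =
              1 / real n *
              (\<Sum>d | d > 0 \<and> d dvd e \<and> ord d q = n \<and> (even e \<longrightarrow> even d).
                 real (card (I_chars d G))))"
proof (intro conjI allI impI)
  have G: "finite_abelian_group G"
    using assms(1,2) by (simp add: finite_abelian_group_def finite_abelian_group_axioms_def)
  obtain \<epsilon> where "finite_representation_setting G (to_ac :: 'f \<Rightarrow> 'f alg_closure) \<epsilon> q"
    using finite_field_setting[OF G assms(4-6)] by blast
  then interpret finite_representation_setting G "to_ac :: 'f \<Rightarrow> 'f alg_closure" \<epsilon> q .
  {
    fix n and \<rho> :: "'g \<Rightarrow> 'f mat" assume irr: "irreducible_rep G n \<rho>"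
    then obtain \<chi> where \<chi>: "\<chi> \<in> chars G" "occurs n \<rho> \<chi>"
      using occurs_exists irreducible_imp_representation irreducible_imp_pos by blast
    show "\<exists>d. d > 0 \<and> d dvd e \<and> n = Pocklington.ord d q"
      using degree_eq_ord[OF irr \<chi>] char_order_pos[OF \<chi>(1)] char_order_dvd_exponent[OF \<chi>(1)] assms(3) by blast
  next
    fix n :: nat assume n: "n > 0"
    show "finite (irrep_classes TYPE('f) G n)" by (rule irrep_classes_count(1)[OF n])
    note irrep_classes_count(2)[OF n]
    also have "card {\<chi> :: 'g \<Rightarrow> 'f alg_closure. \<chi> \<in> chars G \<and> Pocklington.ord (char_order G \<chi>) q = n} =
        card {\<chi> :: 'g \<Rightarrow> complex. \<chi> \<in> chars G \<and> Pocklington.ord (char_order G \<chi>) q = n}"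
      by (rule card_chars_eq[OF \<epsilon> prim_root_zeta[OF exponent_pos]])
    also have "\<dots> = (\<Sum>d | d > 0 \<and> d dvd e \<and> Pocklington.ord d q = n \<and> (even e \<longrightarrow> even d). card (I_chars d G))"
      unfolding assms(3) by (rule sum_I_chars[OF assms(5), symmetric])
    finally have "n * card (irrep_classes TYPE('f) G n) =
        (\<Sum>d | d > 0 \<and> d dvd e \<and> Pocklington.ord d q = n \<and> (even e \<longrightarrow> even d). card (I_chars d G))" .
    from arg_cong[OF this, of real] show "real (card (irrep_classes TYPE('f) G n)) = 1 / real n *
        (\<Sum>d | d > 0 \<and> d dvd e \<and> Pocklington.ord d q = n \<and> (even e \<longrightarrow> even d). real (card (I_chars d G)))"
      using n by (simp add: field_simps)
  }
qed

end
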